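(* Let $n\ge 3$. If $n$ is even, the only RSK-complete cycle type of permutations of $\{1,\dots,n\}$ is $(n)$. If $n$ is odd, the RSK-complete cycle types of permutations of $\{1,\dots,n\}$ are exactly $(n)$ and $(n-1,1)$.
   Context: A cycle type (cycle decomposition) is a partition $\mu=(n_1\ge n_2\ge\dots\ge n_k)$ of $n$ listing the cycle lengths of a permutation, fixed points counted as cycles of length $1$. For a permutation $\sigma=(\sigma_1,\dots,\sigma_n)$ of $\{1,\dots,n\}$, $P(\sigma)$ is its Robinson--Schensted--Knuth insertion tableau (insert $\sigma_1,\sigma_2,\dots$ in order by Schensted row insertion: to insert $a$ into row $r$, if row $r$ is empty or $a$ exceeds all its entries append $a$ and stop, otherwise replace the leftmost entry $b>a$ by $a$ and insert $b$ into row $r+1$), and $\Gamma(P(\sigma))$ is its shape (row lengths, nonincreasing). A cycle type $\mu$ of $n$ is RSK-complete if for every partition $\lambda$ of $n$ other than $(n)$ and $(1,1,\dots,1)$ there is a permutation $\sigma$ of $\{1,\dots,n\}$ with cycle type $\mu$ and $\Gamma(P(\sigma))=\lambda$. *)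

theory Defs
  imports Main "HOL-Library.Multiset" "HOL-Combinatorics.Permutations" "HOL-Combinatorics.Orbits"
begin

definition is_partition :: "nat \<Rightarrow> nat list \<Rightarrow> bool" where
  "is_partition n \<nu> \<longleftrightarrow>
     sorted_wrt (\<ge>) \<nu> \<and> (\<forall>x\<in>set \<nu>. 0 < x) \<and> sum_list \<nu> = n"

text \<open>For \<open>\<sigma>\<close> permuting \<open>{1..n}\<close> the sets \<open>orbit \<sigma> i\<close> are the supports of the cycles of \<open>\<sigma>\<close>,
  a fixed point \<open>i\<close> giving \<open>{i}\<close>; each cycle contributes its length once, because the
  orbits are first collected in a set.\<close>

definition cycle_type :: "nat \<Rightarrow> (nat \<Rightarrow> nat) \<Rightarrow> nat list" where
  "cycle_type n \<sigma> =
     rev (sorted_list_of_multiset (image_mset card (mset_set (orbit \<sigma> ` {1..n}))))"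

text \<open>Schensted insertion of a number into a single row: the new row, and the entry bumped
  out of it, if any.\<close>

fun row_insert :: "nat \<Rightarrow> nat list \<Rightarrow> nat list \<times> nat option" where
  "row_insert a [] = ([a], None)"
| "row_insert a (b # r) =
     (if a < b then (a # r, Some b)
      else (case row_insert a r of (r', x) \<Rightarrow> (b # r', x)))"

fun tableau_insert :: "nat \<Rightarrow> nat list list \<Rightarrow> nat list list" where
  "tableau_insert a [] = [[a]]"
| "tableau_insert a (r # T) =
     (case row_insert a r of
        (r', None) \<Rightarrow> r' # T
      | (r', Some b) \<Rightarrow> r' # tableau_insert b T)"

definition insertion_tableau :: "nat \<Rightarrow> (nat \<Rightarrow> nat) \<Rightarrow> nat list list" where
  "insertion_tableau n \<sigma> = fold tableau_insert (map \<sigma> [1..<Suc n]) []"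

definition shape :: "nat list list \<Rightarrow> nat list" where
  "shape T = map length T"

definition RSK_complete :: "nat \<Rightarrow> nat list \<Rightarrow> bool" where
  "RSK_complete n \<mu> \<longleftrightarrow>
     is_partition n \<mu> \<and>
     (\<forall>\<nu>. is_partition n \<nu> \<and> \<nu> \<noteq> [n] \<and> \<nu> \<noteq> replicate n 1 \<longrightarrow>
        (\<exists>\<sigma>. \<sigma> permutes {1..n} \<and> cycle_type n \<sigma> = \<mu> \<and>
             shape (insertion_tableau n \<sigma>) = \<nu>))"

end

theory Submission
  imports Defs
begin

text \<open>Sufficiency. Take a permutation of \<open>{1..n}\<close> with last letter \<open>x\<close> and replace \<open>x\<close> by a decreasing
  run of \<open>h\<close> new maxima into which \<open>x\<close> is inserted, not at the very end. The shape of the insertion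
  tableau then grows by a column of height \<open>h\<close>. The cycle through \<open>n\<close> absorbs all new points if \<open>x\<close> is
  placed in the middle of the run; for odd \<open>h\<close> it can also be placed so that only the central new point
  stays out and is fixed. Starting from explicit words for hooks and for shapes with two columns, one
  adds second columns until any shape that is neither a row nor a column is reached by a full cycle.
  For odd \<open>n\<close> and two equal first rows the same process yields a cycle avoiding one fixed point; if
  the first row is longer than the second, \<open>n\<close> is appended as a fixed point to a full cycle of \<open>{1..n-1}\<close>.

  Necessity. Shape \<open>(n-1,1)\<close> makes the permutation increasing off one point, so that it has only one
  nontrivial cycle. Shape \<open>(n - n div 2, n div 2)\<close> leaves at most \<open>n mod 2\<close> fixed points: there is no
  decreasing triple, hence the left-to-right maxima form an increasing sequence, and so do the
  remaining points together with the fixed points; both have length at most \<open>n - n div 2\<close>.\<close>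

section \<open>Insertion and maximal letters\<close>

definition rsk :: "nat list \<Rightarrow> nat list list" where
  "rsk w = fold tableau_insert w []"

lemma rsk_snoc: "rsk (w @ [a]) = tableau_insert a (rsk w)"
  by (simp add: rsk_def)

lemma row_insert_append: "\<forall>x\<in>set r. x \<le> a \<Longrightarrow> row_insert a r = (r @ [a], None)"
  by (induction r) auto

lemma row_insert_bump:
  "\<lbrakk>\<forall>x\<in>set u. x \<le> a; a < b\<rbrakk> \<Longrightarrow> row_insert a (u @ b # v) = (u @ a # v, Some b)"
  by (induction u) auto

lemma row_insert_cases:
  fixes r :: "nat list"
  obtains (append) "\<forall>x\<in>set r. x \<le> a"
  | (bump) u b v where "r = u @ b # v" "\<forall>x\<in>set u. x \<le> a" "a < b"
proof (cases "\<exists>x\<in>set r. a < x")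
  case True
  then obtain u b v where "r = u @ b # v" "a < b" "\<forall>y\<in>set u. \<not> a < y"
    using split_list_first_prop[of r "\<lambda>x. a < x"] by blast
  then show ?thesis using bump by (simp add: not_less)
next
  case False
  then show ?thesis using append by (simp add: not_less)
qed

lemma tableau_insert_append:
  "\<forall>x\<in>set r. x \<le> a \<Longrightarrow> tableau_insert a (r # T) = (r @ [a]) # T"
  by (simp add: row_insert_append)

lemma tableau_insert_bump:
  "\<lbrakk>\<forall>x\<in>set u. x \<le> a; a < b\<rbrakk>
    \<Longrightarrow> tableau_insert a ((u @ b # v) # T) = (u @ a # v) # tableau_insert b T"
  by (simp add: row_insert_bump)

text \<open>If the letters of \<open>L\<close> exceed those of \<open>T\<close>, this is the tableau
  after they have been inserted in decreasing order: each one enters the first row and pushes its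
  predecessors down by one row.\<close>

fun attach :: "'a list list \<Rightarrow> 'a list \<Rightarrow> 'a list list" where
  "attach T [] = T"
| "attach [] (l # L) = [l] # attach [] L"
| "attach (r # T) (l # L) = (r @ [l]) # attach T L"

text \<open>Nothing in the first row of \<open>T\<close> exceeds \<open>m\<close>, so
  \<open>m\<close> bumps the attached letter there, if any, which then does the same one row
  below.\<close>

lemma tableau_insert_attach:
  assumes "sorted_wrt (<) (m # L)"
    and "\<And>i x. \<lbrakk>i < length T; i < length (m # L); x \<in> set (T ! i)\<rbrakk> \<Longrightarrow> x < (m # L) ! i"
  shows "tableau_insert m (attach T L) = attach T (m # L)"
  using assms
proof (induction T L arbitrary: m rule: attach.induct)
  case (1 T)
  show ?case
  proof (cases T)
    case (Cons r T')
    have "\<forall>x\<in>set r. x \<le> m" using 1(2)[of 0] Cons by (auto intro: less_imp_le)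
    then show ?thesis using Cons by (simp add: row_insert_append)
  qed simp
next
  case (2 l L)
  then show ?case by simp
next
  case (3 r T l L)
  have r: "\<forall>x\<in>set r. x \<le> m" using 3(3)[of 0] by (auto intro: less_imp_le)
  have "tableau_insert l (attach T L) = attach T (l # L)"
  proof (rule 3(1))
    show "sorted_wrt (<) (l # L)" using 3(2) by simp
    show "x < (l # L) ! i" if "i < length T" "i < length (l # L)" "x \<in> set (T ! i)" for i x
      using 3(3)[of "Suc i" x] that by simp
  qed
  then show ?case using tableau_insert_bump[OF r, of l "[]"] 3(2) by simp
qed

text \<open>Each letter of the run moves the attached column down by a row. Before the end of the
  run, row \<open>i\<close> carries a letter at least as large as its final one, so comparing
  \<open>T\<close> with the final column is enough.\<close>

lemma fold_tableau_insert_attach: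
  assumes "sorted_wrt (<) (K @ L)"
    and "\<And>i x. \<lbrakk>i < length T; i < length (K @ L); x \<in> set (T ! i)\<rbrakk> \<Longrightarrow> x < (K @ L) ! i"
  shows "fold tableau_insert (rev K) (attach T L) = attach T (K @ L)"
  using assms
proof (induction K arbitrary: L rule: rev_induct)
  case (snoc k K)
  have "fold tableau_insert (rev (K @ [k])) (attach T L)
      = fold tableau_insert (rev K) (tableau_insert k (attach T L))" by simp
  also have "tableau_insert k (attach T L) = attach T (k # L)"
  proof (rule tableau_insert_attach)
    show "sorted_wrt (<) (k # L)" using snoc.prems(1) by (simp add: sorted_wrt_append)
    show "x < (k # L) ! i" if i: "i < length T" "i < length (k # L)" "x \<in> set (T ! i)" for i x
    proof -
      have "x < ((K @ [k]) @ L) ! i" using snoc.prems(2)[of i x] i by simp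
      also have "\<dots> = (K @ (k # L)) ! i" by simp
      also have "\<dots> \<le> (K @ (k # L)) ! (length K + i)"
      proof (cases "length K")
        case (Suc m)
        then show ?thesis using snoc.prems(1) i
          by (intro less_imp_le sorted_wrt_nth_less[of "(<)"]) auto
      qed simp
      finally show ?thesis by (simp add: nth_append)
    qed
  qed
  also have "fold tableau_insert (rev K) \<dots> = attach T (K @ k # L)"
    using snoc.prems by (intro snoc.IH) auto
  finally show ?case by simp
qed simp

lemma tableau_insert_neq_Nil: "tableau_insert a T \<noteq> []"
  by (cases T) (auto split: prod.split option.split)

lemma set_hd_tableau_insert:
  assumes "\<forall>r\<in>set T. \<forall>y\<in>set r. y < m" "x < m" "y \<in> set (hd (tableau_insert x T))"
  shows "y < m"
proof (cases T)
  case Nil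
  then show ?thesis using assms by simp
next
  case (Cons r T')
  then show ?thesis using assms
    by (cases rule: row_insert_cases[of r x]) (auto simp: row_insert_append row_insert_bump)
qed

text \<open>A small letter \<open>x\<close> may interrupt the decreasing run if another large letter
  follows. If \<open>x\<close> bumps nothing in the first row of \<open>T\<close>, it displaces the
  attached letter and \<open>m\<close> is appended behind \<open>x\<close>. Otherwise
  \<open>x\<close> bumps some \<open>b\<close> and \<open>m\<close> bumps the attached letter
  \<open>l\<close>; then \<open>b\<close> followed by \<open>l\<close> is the same situation one row
  below.\<close>

lemma tableau_insert_attach_small:
  assumes "x < m" "sorted_wrt (<) (m # L)" "\<forall>r\<in>set T. \<forall>y\<in>set r. y < m"
  shows "tableau_insert m (tableau_insert x (attach T L)) = attach (tableau_insert x T) (m # L)"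
  using assms
proof (induction T L arbitrary: m x rule: attach.induct)
  case (1 T)
  obtain r T' where rT: "tableau_insert x T = r # T'"
    by (meson list.exhaust tableau_insert_neq_Nil)
  then have "\<forall>y\<in>set r. y \<le> m"
    using set_hd_tableau_insert[OF 1(3,1)] by (fastforce intro: less_imp_le)
  then show ?case using rT by (simp add: row_insert_append)
next
  case (2 l L)
  have "tableau_insert l (attach [] L) = attach [] (l # L)"
    using 2(3) by (intro tableau_insert_attach) auto
  then show ?case using 2 by simp
next
  case (3 r T l L)
  have small: "x < m" "m < l" "\<forall>y\<in>set r. y < m" "\<forall>r\<in>set T. \<forall>y\<in>set r. y < l"
    using 3(2-4) by auto (meson order.strict_trans)
  show ?case
  proof (cases rule: row_insert_cases[of r x])
    case append
    have "tableau_insert l (attach T L) = attach T (l # L)"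
    proof (rule tableau_insert_attach)
      show "sorted_wrt (<) (l # L)" using 3(3) by simp
      show "y < (l # L) ! i" if "i < length T" "i < length (l # L)" "y \<in> set (T ! i)" for i y
      proof -
        have "l \<le> (l # L) ! i" using that(2) 3(3) by (cases i) (auto intro: less_imp_le)
        then show ?thesis using small(4) that(1,3) by (meson nth_mem order_less_le_trans)
      qed
    qed
    then show ?thesis
      using append small tableau_insert_bump[OF append, of l "[]"]
        tableau_insert_append[of "r @ [x]" m] tableau_insert_append[OF append]
      by (auto simp: less_imp_le)
  next
    case (bump u b v)
    have b: "b < l" "b < m" using bump(1) small by auto
    have "tableau_insert m (tableau_insert x (attach (r # T) (l # L)))
        = tableau_insert m ((u @ x # v @ [l]) # tableau_insert b (attach T L))"
      using tableau_insert_bump[OF bump(2,3), of "v @ [l]"] bump(1) by simp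
    also have "\<dots> = (u @ x # v @ [m]) # tableau_insert l (tableau_insert b (attach T L))"
      using tableau_insert_bump[of "u @ x # v" m l "[]"] small bump(1) by (auto simp: less_imp_le)
    also have "tableau_insert l (tableau_insert b (attach T L)) = attach (tableau_insert b T) (l # L)"
      using 3 b small by (intro 3(1)) auto
    finally show ?thesis
      using tableau_insert_bump[OF bump(2,3)] bump(1) by simp
  qed
qed

text \<open>On Young diagrams this adjoins a column of height \<open>h\<close>, however
  \<open>h\<close> compares with the number of rows.\<close>

fun add_column :: "nat \<Rightarrow> nat list \<Rightarrow> nat list" where
  "add_column 0 \<nu> = \<nu>"
| "add_column (Suc h) [] = 1 # add_column h []"
| "add_column (Suc h) (x # \<nu>) = Suc x # add_column h \<nu>"

lemma shape_attach: "shape (attach T L) = add_column (length L) (shape T)"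
  by (induction T L rule: attach.induct) (auto simp: shape_def)

lemma set_tableau_insert:
  "(\<Union>r\<in>set (tableau_insert a T). set r) = insert a (\<Union>r\<in>set T. set r)"
proof (induction T arbitrary: a)
  case (Cons r T)
  show ?case
  proof (cases rule: row_insert_cases[of r a])
    case append
    then show ?thesis using tableau_insert_append[OF append, of T] by auto
  next
    case (bump u b v)
    have "tableau_insert a (r # T) = (u @ a # v) # tableau_insert b T"
      using bump tableau_insert_bump by simp
    then show ?thesis using Cons.IH[of b] bump(1) by auto
  qed
qed simp

lemma set_rsk: "(\<Union>r\<in>set (rsk w). set r) = set w"
proof (induction w rule: rev_induct)
  case Nil
  then show ?case by (simp add: rsk_def)
next
  case (snoc a w)
  then show ?case using set_tableau_insert[of a "rsk w"] rsk_snoc[of w a] by simp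
qed

text \<open>The place of \<open>x\<close> inside the run does not affect the shape: \<open>M\<close>
  is attached to the tableau of \<open>w\<close>, the first letter of \<open>N\<close> repairs the
  disturbance by \<open>x\<close>, and the rest of \<open>N\<close> pushes the column on. That
  repair is why \<open>N\<close> is nonempty.\<close>

lemma shape_rsk_insert_column:
  assumes "sorted_wrt (>) (M @ N)" "N \<noteq> []" "\<forall>m\<in>set (M @ N). \<forall>y\<in>set (w @ [x]). y < m"
  shows "shape (rsk (w @ M @ x # N)) = add_column (length (M @ N)) (shape (rsk (w @ [x])))"
proof -
  obtain m N' where N: "N = m # N'" using assms(2) by (cases N) auto
  have w: "y \<in> set w" if "i < length (rsk w)" "y \<in> set (rsk w ! i)" for i y
    using that set_rsk[of w] nth_mem by blast
  have wx: "y \<in> set (w @ [x])" if "i < length (rsk (w @ [x]))" "y \<in> set (rsk (w @ [x]) ! i)" for i y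
    using that set_rsk[of "w @ [x]"] nth_mem by blast
  have s: "sorted_wrt (<) (rev N' @ m # rev M)" "sorted_wrt (<) (m # rev M)" "sorted_wrt (<) (rev M)"
    using assms(1) by (auto simp: N sorted_wrt_append sorted_wrt_rev)
  have "rsk (w @ M @ x # N)
      = fold tableau_insert N' (tableau_insert m (tableau_insert x (fold tableau_insert (rev (rev M)) (attach (rsk w) []))))"
    by (simp add: rsk_def N)
  also have "fold tableau_insert (rev (rev M)) (attach (rsk w) []) = attach (rsk w) (rev M @ [])"
  proof (rule fold_tableau_insert_attach)
    show "y < (rev M @ []) ! i"
      if "i < length (rsk w)" "i < length (rev M @ [])" "y \<in> set (rsk w ! i)" for i y
    proof -
      have "(rev M @ []) ! i \<in> set (M @ N)" using that(2) nth_mem[of i "rev M"] by simp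
      then show ?thesis using assms(3) w[OF that(1,3)] by simp
    qed
  qed (use s in simp)
  also have "tableau_insert m (tableau_insert x (attach (rsk w) (rev M @ [])))
      = attach (rsk (w @ [x])) (m # rev M)"
    unfolding rsk_snoc append_Nil2
  proof (rule tableau_insert_attach_small)
    show "\<forall>r\<in>set (rsk w). \<forall>y\<in>set r. y < m" using assms(3) set_rsk[of w] by (auto simp: N)
  qed (use assms(3) s in \<open>auto simp: N\<close>)
  also have "fold tableau_insert N' \<dots> = fold tableau_insert (rev (rev N')) \<dots>" by simp
  also have "\<dots> = attach (rsk (w @ [x])) (rev N' @ m # rev M)"
  proof (rule fold_tableau_insert_attach[OF s(1)])
    show "y < (rev N' @ m # rev M) ! i"
      if "i < length (rsk (w @ [x]))" "i < length (rev N' @ m # rev M)"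
        "y \<in> set (rsk (w @ [x]) ! i)" for i y
    proof -
      have "(rev N' @ m # rev M) ! i \<in> set (M @ N)"
        using nth_mem[OF that(2)] by (auto simp: N)
      then show ?thesis using assms(3) wx[OF that(1,3)] by blast
    qed
  qed
  finally show ?thesis by (simp add: shape_attach N add.commute)
qed

text \<open>\<open>A\<close> alone gives a single column with its smallest letter on top. The
  comparison of \<open>rev A\<close> with \<open>rev B\<close> says that the rows of the final
  tableau increase, so \<open>B\<close> settles as a second column.\<close>

lemma shape_rsk_two_columns:
  assumes "sorted_wrt (>) A" "sorted_wrt (>) B" "length B \<le> length A"
    and "\<And>i. i < length B \<Longrightarrow> rev A ! i < rev B ! i"
  shows "shape (rsk (A @ B)) = add_column (length B) (replicate (length A) 1)"
proof -
  have A: "rsk A = map (\<lambda>a. [a]) (rev A)"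
  proof -
    have "rsk A = fold tableau_insert (rev (rev A)) (attach [] [])" by (simp add: rsk_def)
    also have "\<dots> = attach [] (rev A @ [])"
      using assms(1) by (intro fold_tableau_insert_attach) (auto simp: sorted_wrt_rev)
    also have "\<dots> = map (\<lambda>a. [a]) (rev A)"
    proof -
      have "attach [] L = map (\<lambda>a. [a]) L" for L :: "nat list" by (induction L) auto
      then show ?thesis by simp
    qed
    finally show ?thesis .
  qed
  have "rsk (A @ B) = fold tableau_insert (rev (rev B)) (attach (rsk A) [])" by (simp add: rsk_def)
  also have "\<dots> = attach (rsk A) (rev B @ [])"
    using assms by (intro fold_tableau_insert_attach) (auto simp: sorted_wrt_rev A)
  finally show ?thesis
    by (simp add: shape_attach A) (simp add: shape_def comp_def map_replicate_const)
qed

lemma rsk_snoc_max: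
  assumes "\<forall>y\<in>set w. y < a" "w \<noteq> []"
  shows "\<exists>r T. rsk w = r # T \<and> rsk (w @ [a]) = (r @ [a]) # T"
proof -
  obtain r T where rT: "rsk w = r # T"
    by (metis append_butlast_last_id assms(2) list.exhaust rsk_snoc tableau_insert_neq_Nil)
  then have "set r \<subseteq> set w" using set_rsk[of w] by auto
  then have "\<forall>x\<in>set r. x \<le> a" using assms(1) by (auto intro: less_imp_le)
  then show ?thesis using rT tableau_insert_append[of r a T] by (simp add: rsk_snoc)
qed

lemma shape_rsk_hook:
  assumes "sorted_wrt (>) A" "sorted_wrt (<) B" "A \<noteq> []" "\<forall>b\<in>set B. last A < b"
  shows "shape (rsk (A @ B)) = (length B + 1) # replicate (length A - 1) 1"
proof -
  have attach: "attach [] L = map (\<lambda>a. [a]) L" for L :: "nat list" by (induction L) auto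
  have "rsk A = fold tableau_insert (rev (rev A)) (attach [] [])" by (simp add: rsk_def)
  also have "\<dots> = attach [] (rev A @ [])"
    using assms(1) by (intro fold_tableau_insert_attach) (auto simp: sorted_wrt_rev)
  finally have A: "rsk A = [last A] # map (\<lambda>a. [a]) (rev (butlast A))"
    using assms(3) by (cases A rule: rev_cases) (simp_all add: attach)
  have "rsk (A @ B) = (last A # B) # map (\<lambda>a. [a]) (rev (butlast A))"
    using assms(2,4)
  proof (induction B rule: rev_induct)
    case (snoc b B)
    then have "rsk (A @ B) = (last A # B) # map (\<lambda>a. [a]) (rev (butlast A))"
      and "\<forall>x\<in>set (last A # B). x \<le> b"
      by (auto simp: sorted_wrt_append less_imp_le)
    then show ?case
      using rsk_snoc[of "A @ B" b] tableau_insert_append[of "last A # B" b] by simp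
  qed (simp add: A)
  then show ?thesis by (simp add: shape_def comp_def map_replicate_const)
qed

section \<open>Inserting a column\<close>

lemma insertion_tableau_eq_rsk: "insertion_tableau n \<sigma> = rsk (map \<sigma> [1..<Suc n])"
  by (simp add: insertion_tableau_def rsk_def)

lemma sorted_wrt_map_upt:
  assumes "\<And>i k. \<lbrakk>a \<le> i; i < k; k < b\<rbrakk> \<Longrightarrow> R (f i) (f k)"
  shows "sorted_wrt R (map f [a..<b])"
  by (auto simp: sorted_wrt_iff_nth_less intro!: assms)

lemma orbit_stepI: "\<lbrakk>y \<in> orbit f x; f y = z\<rbrakk> \<Longrightarrow> z \<in> orbit f x"
  using orbit.step by fast

text \<open>The point \<open>n\<close> has to lie on the cycle: this is where new points are grafted.\<close>

definition cycle_off :: "nat \<Rightarrow> nat set \<Rightarrow> (nat \<Rightarrow> nat) \<Rightarrow> bool" where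
  "cycle_off n F \<sigma> \<longleftrightarrow> \<sigma> permutes {1..n} \<and> F \<subseteq> {1..<n} \<and> (\<forall>f\<in>F. \<sigma> f = f)
     \<and> cyclic_on \<sigma> ({1..n} - F)"

text \<open>It suffices to reach all points outside \<open>F\<close> from \<open>a\<close>. Points
  of an orbit are values of \<open>\<sigma>\<close>, and so are fixed points; hence
  \<open>\<sigma>\<close> is onto and, by finiteness, bijective. Orbits of a permutation are
  symmetric, so no fixed point lies on the orbit of \<open>a\<close>.\<close>

lemma cycle_offI:
  assumes "\<And>i. i \<in> {1..n} \<Longrightarrow> \<sigma> i \<in> {1..n}" "\<And>i. i \<notin> {1..n} \<Longrightarrow> \<sigma> i = i"
    and F: "F \<subseteq> {1..<n}" "\<And>f. f \<in> F \<Longrightarrow> \<sigma> f = f"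
    and a: "a \<in> {1..n} - F" "{1..n} - F \<subseteq> orbit \<sigma> a"
  shows "cycle_off n F \<sigma>"
proof -
  have "y \<in> \<sigma> ` {1..n} \<and> y \<in> {1..n}" if "y \<in> orbit \<sigma> a" for y
    using that by induction (use a(1) assms(1) in blast)+
  moreover have "F \<subseteq> \<sigma> ` {1..n}" using F by force
  ultimately have "{1..n} \<subseteq> \<sigma> ` {1..n}" using a(2) by blast
  then have "bij_betw \<sigma> {1..n} {1..n}"
    using assms(1) finite_surj_inj[of "{1..n}" \<sigma>] unfolding bij_betw_def by blast
  then have perm: "\<sigma> permutes {1..n}" using assms(2) by (rule bij_imp_permutes)
  then have "permutation \<sigma>" by (auto simp: permutation_permutes)
  have "f \<notin> orbit \<sigma> a" if "f \<in> F" for f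
  proof
    assume "f \<in> orbit \<sigma> a"
    then have "a \<in> orbit \<sigma> f"
      using orbit_swap permutation_self_in_orbit[OF \<open>permutation \<sigma>\<close>] by metis
    moreover have "orbit \<sigma> f = {f}" using F(2)[OF that] by (simp add: orbit_eq_singleton_iff)
    ultimately show False using a(1) that by simp
  qed
  then have "{1..n} - F = orbit \<sigma> a"
    using a permutes_orbit_subset[OF perm, of a] by blast
  then show ?thesis using perm F a(1) by (auto simp: cycle_off_def cyclic_on_def)
qed

lemma cycle_type_cyclic:
  assumes "\<sigma> permutes {1..n}" "n \<ge> 1" "cyclic_on \<sigma> {1..n}"
  shows "cycle_type n \<sigma> = [n]"
proof -
  have "orbit \<sigma> ` {1..n} = {{1..n}}"
    using assms orbit_cyclic_eq3[OF assms(3)] by auto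
  then show ?thesis by (simp add: cycle_type_def)
qed

lemma cycle_type_fixed_point:
  assumes "f \<in> {1..n}" "\<sigma> f = f" "n \<ge> 2" "cyclic_on \<sigma> ({1..n} - {f})"
  shows "cycle_type n \<sigma> = [n - 1, 1]"
proof -
  define S where "S = {1..n} - {f}"
  have cyc: "cyclic_on \<sigma> S" using assms(4) by (simp only: S_def)
  then have "S \<noteq> {}" unfolding cyclic_on_def by blast
  moreover have "f \<notin> S" "finite S" "card S = n - 1" and n: "{1..n} = insert f S"
    using assms(1) by (auto simp: S_def)
  ultimately have S: "S \<noteq> {}" "f \<notin> S" "card S = n - 1" by simp_all
  have "orbit \<sigma> ` S = {S}" using S(1) orbit_cyclic_eq3[OF cyc] by blast
  moreover have "orbit \<sigma> f = {f}" using assms(2) by (simp add: orbit_eq_singleton_iff)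
  ultimately have "orbit \<sigma> ` {1..n} = {{f}, S}" by (simp only: n image_insert)
  \<comment> \<open>The orbits have to differ as sets in order to be counted separately; for
    \<open>n = 2\<close> their sizes agree.\<close>
  moreover have "{f} \<noteq> S" using S(2) by blast
  ultimately show ?thesis using assms(3) S(3) by (simp add: cycle_type_def)
qed

text \<open>The last letter of \<open>\<sigma>\<close> moves to position \<open>n + j\<close>,
  inside a decreasing run of \<open>h\<close> new maxima. The three relations between
  \<open>h\<close> and \<open>j\<close> place it close enough to the middle for at most one new
  point to stay off the cycle.\<close>

lemma insert_column:
  assumes \<sigma>: "cycle_off n F \<sigma>" and j: "0 < j" "j < h" and h: "h = 2 * j \<or> h + 1 = 2 * j \<or> h = 2 * j + 1"
  obtains \<tau> where "cycle_off (n + h) (if h = 2 * j + 1 then insert (n + j + 1) F else F) \<tau>"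
    "shape (insertion_tableau (n + h) \<tau>) = add_column h (shape (insertion_tableau n \<sigma>))"
proof -
  \<comment> \<open>In one-line notation: \<open>\<sigma> 1, ..., \<sigma> (n - 1)\<close>, then
    \<open>j\<close> letters descending from \<open>n + h\<close>, then \<open>\<sigma> n\<close>,
    then the rest of the run down to \<open>n + 1\<close>.\<close>
  define \<tau> where "\<tau> i = (if i < n then \<sigma> i else if i < n + j then 2 * n + h - i
      else if i = n + j then \<sigma> n else if i \<le> n + h then 2 * n + h + 1 - i else i)" for i
  let ?F = "if h = 2 * j + 1 then insert (n + j + 1) F else F"
  have perm: "\<sigma> permutes {1..n}" and F: "F \<subseteq> {1..<n}" "\<And>f. f \<in> F \<Longrightarrow> \<sigma> f = f"
    and cyc: "cyclic_on \<sigma> ({1..n} - F)"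
    using \<sigma> by (auto simp: cycle_off_def)
  have n: "1 \<le> n" "n \<in> {1..n} - F"
  proof -
    have "{1..n} - F \<noteq> {}" using cyc unfolding cyclic_on_def by blast
    then show "1 \<le> n" by auto
    then show "n \<in> {1..n} - F" using F(1) by auto
  qed
  have in_range: "\<sigma> i \<in> {1..n}" if "i \<in> {1..n}" for i
    using permutes_in_image[OF perm] that by blast
  \<comment> \<open>The path from \<open>n\<close> is a zigzag: \<open>n + h\<close>,
    \<open>n + 1\<close>, \<open>n + h - 1\<close>, \<open>n + 2\<close>, and so on. For
    \<open>t = 0\<close> nothing is claimed about \<open>n\<close> itself, which is reached only
    when the cycle closes.\<close>
  have chain: "t < j \<longrightarrow> (t = 0 \<or> n + t \<in> orbit \<tau> n) \<and> n + h - t \<in> orbit \<tau> n" for t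
  proof (induction t)
    case 0
    have "\<tau> n = n + h" using j by (simp add: \<tau>_def)
    then show ?case using orbit.base[of \<tau> n] by simp
  next
    case (Suc t)
    show ?case
    proof
      assume t: "Suc t < j"
      have "n + h - t \<in> orbit \<tau> n" using Suc t by simp
      moreover have "\<tau> (n + h - t) = n + Suc t" using t h by (auto simp: \<tau>_def)
      ultimately have 1: "n + Suc t \<in> orbit \<tau> n" by (rule orbit_stepI)
      moreover have "\<tau> (n + Suc t) = n + h - Suc t" using t h by (auto simp: \<tau>_def)
      ultimately show "(Suc t = 0 \<or> n + Suc t \<in> orbit \<tau> n) \<and> n + h - Suc t \<in> orbit \<tau> n"
        by (blast intro: orbit_stepI)
    qed
  qed
  \<comment> \<open>The zigzag ends at \<open>n + j\<close>: if \<open>h + 1 = 2 * j\<close>, this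
    is already its last upper point; otherwise one more step leads there.\<close>
  have nj: "n + j \<in> orbit \<tau> n"
  proof -
    have *: "n + h - (j - 1) \<in> orbit \<tau> n" using chain[of "j - 1"] j by simp
    show ?thesis
    proof (cases "h + 1 = 2 * j")
      case True
      then have "n + h - (j - 1) = n + j" by simp
      then show ?thesis using * by simp
    next
      case False
      then have "\<tau> (n + h - (j - 1)) = n + j" using h j by (auto simp: \<tau>_def)
      then show ?thesis by (rule orbit_stepI[OF *])
    qed
  qed
  have \<tau>_eq: "\<tau> (n + j) = \<sigma> n" using j by (simp add: \<tau>_def)
  have \<sigma>n: "\<sigma> n \<in> orbit \<tau> n" by (rule orbit_stepI[OF nj \<tau>_eq])
  \<comment> \<open>Below \<open>n\<close> the maps agree, and the step from \<open>n\<close> to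
    \<open>\<sigma> n\<close> is replaced by the detour through the new points.\<close>
  have old: "y \<in> orbit \<tau> n" if "y \<in> orbit \<sigma> n" for y
    using that
  proof induction
    case base
    then show ?case by (rule \<sigma>n)
  next
    case (step y)
    have "y \<in> {1..n}" using permutes_orbit_subset[OF perm, of n] n step by auto
    moreover have "\<tau> y = \<sigma> y" if "y < n" using that by (simp add: \<tau>_def)
    ultimately show ?case
      using \<sigma>n orbit_stepI[OF step.IH, of "\<sigma> y"] by (cases "y = n") auto
  qed
  have orb: "orbit \<sigma> n = {1..n} - F" using cyc n(2) by (simp add: orbit_cyclic_eq3)
  have "{1..n+h} - ?F \<subseteq> orbit \<tau> n"
  proof
    fix y assume y: "y \<in> {1..n+h} - ?F"
    consider "y \<le> n" | "n < y" "y < n + j" | "y = n + j" | "n + j < y" "n + h - y < j"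
      | "n + j < y" "j \<le> n + h - y" by linarith
    then show "y \<in> orbit \<tau> n"
    proof cases
      case 1
      then show ?thesis using old orb y by (auto split: if_splits)
    next
      case 2
      then show ?thesis using chain[of "y - n"] by simp
    next
      case 3
      then show ?thesis using nj by simp
    next
      case 4
      then show ?thesis using chain[of "n + h - y"] y by simp
    next
      \<comment> \<open>Only the centre of the run can be missed, and then it is the new fixed
        point.\<close>
      case 5
      then have "h = 2 * j + 1 \<and> y = n + j + 1" using h j by linarith
      then show ?thesis using y by simp
    qed
  qed
  moreover have "\<tau> f = f" if "f \<in> ?F" for f
    using that F j by (auto simp: \<tau>_def split: if_splits)
  moreover have "?F \<subseteq> {1..<n+h}" "n \<in> {1..n+h} - ?F" using F(1) n j by auto
  moreover have "\<tau> i \<in> {1..n+h}" if "i \<in> {1..n+h}" for i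
    using that in_range[of i] in_range[of n] n j by (auto simp: \<tau>_def)
  moreover have "\<tau> i = i" if "i \<notin> {1..n+h}" for i
    using that n j permutes_not_in[OF perm, of i] by (cases "i = 0") (simp_all add: \<tau>_def)
  ultimately have "cycle_off (n + h) ?F \<tau>" by (blast intro: cycle_offI)
  moreover have "shape (insertion_tableau (n + h) \<tau>) = add_column h (shape (insertion_tableau n \<sigma>))"
  proof -
    let ?M = "map (\<lambda>i. 2 * n + h - i) [n..<n+j]" and ?N = "map (\<lambda>i. 2 * n + h + 1 - i) [n+j+1..<n+h+1]"
    have "[1..<Suc (n + h)] = [1..<n] @ [n..<n+j] @ (n + j) # [n+j+1..<n+h+1]"
    proof -
      have "[1..<Suc (n + h)] = [1..<n] @ [n..<Suc (n + h)]"
        using upt_add_eq_append[of 1 n "Suc h"] n by simp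
      also have "[n..<Suc (n + h)] = [n..<n+j] @ [n+j..<Suc (n + h)]"
        using upt_add_eq_append[of n "n + j" "Suc h - j"] j by simp
      also have "[n+j..<Suc (n + h)] = (n + j) # [n+j+1..<n+h+1]"
        using j by (simp add: upt_conv_Cons)
      finally show ?thesis .
    qed
    moreover have "map \<tau> [1..<n] = map \<sigma> [1..<n]" by (simp add: \<tau>_def)
    moreover have "map \<tau> [n..<n+j] = ?M" by (simp add: \<tau>_def)
    moreover have "map \<tau> [n+j+1..<n+h+1] = ?N" by (simp add: \<tau>_def)
    ultimately have \<tau>: "map \<tau> [1..<Suc (n + h)] = map \<sigma> [1..<n] @ ?M @ \<sigma> n # ?N"
      using \<tau>_eq by (simp only: map_append list.map)
    have \<sigma>: "map \<sigma> [1..<Suc n] = map \<sigma> [1..<n] @ [\<sigma> n]" using n by simp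
    have "shape (rsk (map \<sigma> [1..<n] @ ?M @ \<sigma> n # ?N))
        = add_column (length (?M @ ?N)) (shape (rsk (map \<sigma> [1..<n] @ [\<sigma> n])))"
    proof (rule shape_rsk_insert_column)
      have "sorted_wrt (>) ?M" "sorted_wrt (>) ?N"
        using j by (intro sorted_wrt_map_upt; simp)+
      moreover have "y < x" if "x \<in> set ?M" "y \<in> set ?N" for x y
        using that j by auto
      ultimately show "sorted_wrt (>) (?M @ ?N)" unfolding sorted_wrt_append by blast
      show "?N \<noteq> []" using j by simp
      show "\<forall>m\<in>set (?M @ ?N). \<forall>y\<in>set (map \<sigma> [1..<n] @ [\<sigma> n]). y < m"
      proof (intro ballI)
        fix m y
        assume "y \<in> set (map \<sigma> [1..<n] @ [\<sigma> n])"
        then obtain i where i: "y = \<sigma> i" "i \<in> {1..n}" unfolding \<sigma>[symmetric] by auto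
        assume "m \<in> set (?M @ ?N)"
        then have "n < m" using j by auto
        then show "y < m" using in_range[OF i(2)] i(1) by simp
      qed
    qed
    moreover have "length (?M @ ?N) = h" using j by simp
    ultimately show ?thesis unfolding insertion_tableau_eq_rsk \<tau> \<sigma> by simp
  qed
  ultimately show ?thesis using that by blast
qed

section \<open>Hooks and two-column shapes\<close>

text \<open>On positions \<open>2, ..., p\<close> stands the run \<open>p, ..., 1\<close> without
  \<open>c\<close>. Two steps, \<open>i\<close> to \<open>p + 2 - i\<close> to \<open>i - 1\<close>,
  lower a point by one. Starting from \<open>min c k\<close>, which is \<open>c\<close> or its
  successor, the orbit sweeps down to \<open>1\<close> and through the mirror images. The exceptions
  are the central point, which is then fixed.\<close>

lemma orbit_first_column:
  fixes c p k y :: nat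
  assumes c: "2 \<le> c" "c \<le> p" "p + 1 = k + c" "c = k \<or> c = k + 1 \<or> c = k + 2 \<or> c + 1 = k"
    and low: "\<And>i. \<lbrakk>2 \<le> i; i \<le> k\<rbrakk> \<Longrightarrow> \<sigma> i = p + 2 - i"
    and high: "\<And>i. \<lbrakk>k < i; i \<le> p\<rbrakk> \<Longrightarrow> \<sigma> i = p + 1 - i"
    and "c \<in> orbit \<sigma> a" and y: "y \<in> {1..p}"
  shows "y \<in> orbit \<sigma> a \<or> c = k + 2 \<and> y = k + 1 \<or> c + 1 = k \<and> y = k"
proof -
  define s where "s = min c k"
  have s: "s \<in> orbit \<sigma> a"
  proof (cases "c \<le> k")
    case True
    then show ?thesis using assms(7) by (simp add: s_def min_absorb1)
  next
    case False
    then have "\<sigma> c = s" using high[of c] c by (simp add: s_def min_def)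
    then show ?thesis by (rule orbit_stepI[OF assms(7)])
  qed
  have 1: "s - t \<in> orbit \<sigma> a" if "t < s" for t
    using that
  proof (induction t)
    case (Suc t)
    have "\<sigma> (s - t) = p + 2 - (s - t)" 
      by (rule low) (use Suc.prems in \<open>auto simp: s_def\<close>)
    then have "p + 2 - (s - t) \<in> orbit \<sigma> a" using Suc orbit_stepI by fastforce
    moreover have "\<sigma> (p + 2 - (s - t)) = p + 1 - (p + 2 - (s - t))"
      by (rule high) (use Suc.prems c in \<open>auto simp: s_def\<close>)
    moreover have "p + 1 - (p + 2 - (s - t)) = s - Suc t"
      using Suc.prems c by (auto simp: s_def)
    ultimately show ?case using orbit_stepI by metis
  qed (use s in simp)
  have 2: "i \<in> orbit \<sigma> a" if "1 \<le> i" "i \<le> s" for i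
    using 1[of "s - i"] that by simp
  have 3: "p + 2 - i \<in> orbit \<sigma> a" if "2 \<le> i" "i \<le> s" for i
    using orbit_stepI[OF 2 low] that by (simp add: s_def)
  consider "y \<le> s" | "p + 2 - y \<le> s" | "s < y" "s < p + 2 - y" by linarith
  then show ?thesis
  proof cases
    case 2
    then have "p + 2 - (p + 2 - y) \<in> orbit \<sigma> a" using y by (intro 3) auto
    then show ?thesis using y by simp
  next
    case 3
    then have "y = c \<or> c = k + 2 \<and> y = k + 1 \<or> c + 1 = k \<and> y = k"
      using c by (auto simp: s_def min_def split: if_splits)
    then show ?thesis using assms(7) by blast
  qed (use 2 y in simp)
qed

text \<open>The same zigzag for the run \<open>p + q, ..., p + 1\<close> without
  \<open>p + e\<close>: two steps take \<open>p + i\<close> to \<open>p + (q + 1 - i)\<close> and on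
  to \<open>p + (i - 1)\<close>. The exception is again a fixed centre.\<close>

lemma orbit_second_column:
  fixes e p q u y :: nat
  assumes e: "1 \<le> e" "1 \<le> u" "q = u + e" "e = u \<or> e = u + 1 \<or> e + 1 = u"
    and low: "\<And>i. \<lbrakk>1 \<le> i; i \<le> u\<rbrakk> \<Longrightarrow> \<sigma> (p + i) = p + q + 1 - i"
    and high: "\<And>i. \<lbrakk>u < i; i < q\<rbrakk> \<Longrightarrow> \<sigma> (p + i) = p + q - i"
    and "p + e \<in> orbit \<sigma> a" and y: "y \<in> {1..q}"
  shows "p + y \<in> orbit \<sigma> a \<or> e + 1 = u \<and> y = u"
proof -
  define s where "s = min e u"
  have s: "p + s \<in> orbit \<sigma> a"
  proof (cases "e \<le> u")
    case True
    then show ?thesis using assms(7) by (simp add: s_def min_absorb1)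
  next
    case False
    then have "\<sigma> (p + e) = p + s" using high[of e] e by (simp add: s_def min_def)
    then show ?thesis by (rule orbit_stepI[OF assms(7)])
  qed
  have 1: "p + (s - t) \<in> orbit \<sigma> a" if "t < s" for t
    using that
  proof (induction t)
    case (Suc t)
    have "\<sigma> (p + (s - t)) = p + (q + 1 - (s - t))"
    proof -
      have "1 \<le> s - t" "s - t \<le> u" using Suc.prems by (auto simp: s_def)
      then show ?thesis using low[of "s - t"] e by simp
    qed
    then have "p + (q + 1 - (s - t)) \<in> orbit \<sigma> a" using Suc orbit_stepI by fastforce
    moreover have "\<sigma> (p + (q + 1 - (s - t))) = p + q - (q + 1 - (s - t))"
      by (rule high) (use Suc.prems e in \<open>auto simp: s_def\<close>)
    moreover have "p + q - (q + 1 - (s - t)) = p + (s - Suc t)"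
      using Suc.prems e by (auto simp: s_def)
    ultimately show ?case using orbit_stepI by metis
  qed (use s in simp)
  have 2: "p + i \<in> orbit \<sigma> a" if "1 \<le> i" "i \<le> s" for i
    using 1[of "s - i"] that by simp
  have 3: "p + (q + 1 - i) \<in> orbit \<sigma> a" if "1 \<le> i" "i \<le> s" for i
  proof (rule orbit_stepI[OF 2[OF that]])
    show "\<sigma> (p + i) = p + (q + 1 - i)" using low[of i] that e by (simp add: s_def)
  qed
  consider "y \<le> s" | "q + 1 - y \<le> s" | "s < y" "s < q + 1 - y" by linarith
  then show ?thesis
  proof cases
    case 2
    then have "p + (q + 1 - (q + 1 - y)) \<in> orbit \<sigma> a" using y by (intro 3) auto
    then show ?thesis using y by simp
  next
    case 3
    then have "y = e \<or> e + 1 = u \<and> y = u"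
      using e by (auto simp: s_def min_def split: if_splits)
    then show ?thesis using assms(7) by blast
  qed (use 2 y in simp)
qed

text \<open>The word is \<open>n\<close>, then \<open>p, \<dots>, 1\<close> without \<open>c\<close>, then \<open>c, p + 1, \<dots>, n - 1\<close>. It arises from the
  word \<open>p, \<dots>, 1, p + 1, \<dots>, n\<close> by a cyclic change of the values \<open>c, \<dots>, n\<close>; for \<open>c\<close> about half of \<open>p\<close>
  each 2-cycle of the initial decreasing run is hit once, so that all cycles are merged.\<close>

lemma hook_permutation:
  assumes c: "2 \<le> c" "c \<le> p" "p + 1 = k + c" "c = k \<or> c = k + 1 \<or> c + 1 = k" and n: "p < n"
  obtains \<tau> where "cycle_off n (if c + 1 = k then {k} else {}) \<tau>"
    "shape (insertion_tableau n \<tau>) = (n - p + 1) # replicate (p - 1) 1"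
proof -
  define \<tau> where "\<tau> i = (if i = 0 then 0 else if i = 1 then n else if i \<le> k then p + 2 - i
    else if i \<le> p then p + 1 - i else if i = p + 1 then c else if i \<le> n then i - 1 else i)" for i
  let ?F = "if c + 1 = k then {k} else {}"
  \<comment> \<open>The path from \<open>1\<close> runs through \<open>n, n - 1, ..., p + 1\<close>
    and then enters the initial run at \<open>c\<close>.\<close>
  have 1: "n - t \<in> orbit \<tau> 1" if "t < n - p" for t
    using that
  proof (induction t)
    case 0
    have "\<tau> 1 = n" by (simp add: \<tau>_def)
    then show ?case using orbit.base[of \<tau> 1] by simp
  next
    case (Suc t)
    have "\<tau> (n - t) = n - Suc t" using Suc.prems c by (auto simp: \<tau>_def)
    moreover have "n - t \<in> orbit \<tau> 1" using Suc by simp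
    ultimately show ?case by (simp only: orbit_stepI)
  qed
  have 2: "y \<in> orbit \<tau> 1" if "p < y" "y \<le> n" for y
    using 1[of "n - y"] that by simp
  have "\<tau> (p + 1) = c" using c by (simp add: \<tau>_def)
  moreover have "p + 1 \<in> orbit \<tau> 1" using 2 n by simp
  ultimately have "c \<in> orbit \<tau> 1" by (simp only: orbit_stepI)
  have 3: "y \<in> orbit \<tau> 1 \<or> c = k + 2 \<and> y = k + 1 \<or> c + 1 = k \<and> y = k" if "y \<in> {1..p}" for y
  proof (rule orbit_first_column[OF c(1-3)])
    show "\<tau> i = p + 2 - i" if "2 \<le> i" "i \<le> k" for i using that by (simp add: \<tau>_def)
    show "\<tau> i = p + 1 - i" if "k < i" "i \<le> p" for i using that c by (auto simp: \<tau>_def)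
  qed (use c(4) that \<open>c \<in> orbit \<tau> 1\<close> in auto)
  have "{1..n} - ?F \<subseteq> orbit \<tau> 1"
  proof
    fix y assume "y \<in> {1..n} - ?F"
    then show "y \<in> orbit \<tau> 1"
      using 2[of y] 3[of y] c(4) by (cases "y \<le> p") (auto split: if_splits)
  qed
  moreover have "?F \<subseteq> {1..<n}" "1 \<in> {1..n} - ?F" "\<And>f. f \<in> ?F \<Longrightarrow> \<tau> f = f"
    using c n by (auto simp: \<tau>_def split: if_splits)
  moreover have "\<tau> i \<in> {1..n}" if "i \<in> {1..n}" for i
    using that c(1-3) n by (auto simp: \<tau>_def)
  moreover have "\<tau> i = i" if "i \<notin> {1..n}" for i
    using that c n by (cases "i = 0") (simp_all add: \<tau>_def)
  ultimately have "cycle_off n ?F \<tau>" by (blast intro: cycle_offI)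
  moreover have "shape (insertion_tableau n \<tau>) = (n - p + 1) # replicate (p - 1) 1"
  proof -
    have "[1..<Suc n] = [1..<Suc p] @ [Suc p..<Suc n]"
      using upt_add_eq_append[of 1 "Suc p" "n - p"] n by simp
    moreover have "shape (rsk (map \<tau> [1..<Suc p] @ map \<tau> [Suc p..<Suc n]))
        = (length (map \<tau> [Suc p..<Suc n]) + 1) # replicate (length (map \<tau> [1..<Suc p]) - 1) 1"
    proof (rule shape_rsk_hook)
      show "sorted_wrt (>) (map \<tau> [1..<Suc p])"
        using c(1-3) n by (intro sorted_wrt_map_upt) (auto simp: \<tau>_def)
      show "sorted_wrt (<) (map \<tau> [Suc p..<Suc n])"
        using c(1-3) by (intro sorted_wrt_map_upt) (auto simp: \<tau>_def)
      show "map \<tau> [1..<Suc p] \<noteq> []" using c by simp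
      have "\<tau> p = 1" using c by (auto simp: \<tau>_def)
      then have last: "last (map \<tau> [1..<Suc p]) = 1" using c(1,2) by simp
      have "1 < \<tau> i" if "i \<in> {Suc p..<Suc n}" for i
        using that c(1,2,3) by (auto simp: \<tau>_def)
      then show "\<forall>b\<in>set (map \<tau> [Suc p..<Suc n]). last (map \<tau> [1..<Suc p]) < b"
        unfolding last by auto
    qed
    ultimately show ?thesis using n c(1,2) unfolding insertion_tableau_eq_rsk by (simp del: upt_Suc)
  qed
  ultimately show ?thesis using that by blast
qed

text \<open>The word is \<open>p + e\<close>, then \<open>p, \<dots>, 1\<close> without \<open>c\<close>, then \<open>p + q, \<dots>, p + 1\<close> without \<open>p + e\<close>, then
  \<open>c\<close>. As before, the values \<open>c, \<dots>, p + e\<close> meet each cycle of \<open>p, \<dots>, 1, p + q, \<dots>, p + 1\<close> once,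
  except possibly for the centre of one of the two runs.\<close>

lemma two_column_permutation:
  assumes c: "2 \<le> c" "c \<le> p" "p + 1 = k + c" "c = k \<or> c = k + 1 \<or> c = k + 2"
    and e: "1 \<le> e" "1 \<le> u" "q = u + e" "e = u \<or> e = u + 1 \<or> e + 1 = u" and "q \<le> p"
  obtains \<tau> where
    "cycle_off (p + q) ((if c = k + 2 then {k + 1} else {}) \<union> (if e + 1 = u then {p + u} else {})) \<tau>"
    "shape (insertion_tableau (p + q) \<tau>) = add_column q (replicate p 1)"
proof -
  define \<tau> where "\<tau> i = (if i = 0 then 0 else if i = 1 then p + e else if i \<le> k then p + 2 - i
    else if i \<le> p then p + 1 - i else if i \<le> p + u then 2 * p + q + 1 - i
    else if i < p + q then 2 * p + q - i else if i = p + q then c else i)" for i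
  let ?F = "(if c = k + 2 then {k + 1} else {}) \<union> (if e + 1 = u then {p + u} else {})"
  \<comment> \<open>The path from \<open>1\<close> enters the second run at \<open>p + e\<close>,
    sweeps it, and leaves through \<open>p + q\<close> to \<open>c\<close> in the first run.\<close>
  have "\<tau> 1 = p + e" by (simp add: \<tau>_def)
  then have pe: "p + e \<in> orbit \<tau> 1" using orbit.base[of \<tau> 1] by simp
  have 1: "p + y \<in> orbit \<tau> 1 \<or> e + 1 = u \<and> y = u" if "y \<in> {1..q}" for y
  proof (rule orbit_second_column[OF e])
    show "\<tau> (p + i) = p + q + 1 - i" if "1 \<le> i" "i \<le> u" for i
      using that c by (simp add: \<tau>_def)
    show "\<tau> (p + i) = p + q - i" if "u < i" "i < q" for i
      using that c by (simp add: \<tau>_def)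
  qed (use pe that in simp_all)
  have "p + q \<in> orbit \<tau> 1" using 1[of q] e by auto
  moreover have "\<tau> (p + q) = c" using c e by (simp add: \<tau>_def)
  ultimately have "c \<in> orbit \<tau> 1" by (rule orbit_stepI)
  have 2: "y \<in> orbit \<tau> 1 \<or> c = k + 2 \<and> y = k + 1 \<or> c + 1 = k \<and> y = k" if "y \<in> {1..p}" for y
  proof (rule orbit_first_column[OF c(1-3)])
    show "\<tau> i = p + 2 - i" if "2 \<le> i" "i \<le> k" for i using that by (simp add: \<tau>_def)
    show "\<tau> i = p + 1 - i" if "k < i" "i \<le> p" for i using that c by (auto simp: \<tau>_def)
  qed (use c(4) that \<open>c \<in> orbit \<tau> 1\<close> in auto)
  have "{1..p+q} - ?F \<subseteq> orbit \<tau> 1"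
  proof
    fix y assume y: "y \<in> {1..p+q} - ?F"
    show "y \<in> orbit \<tau> 1"
    proof (cases "y \<le> p")
      case True
      then show ?thesis using 2[of y] y c(4) by (auto split: if_splits)
    next
      case False
      then have "y - p \<in> {1..q}" "p + (y - p) = y" using y by auto
      then show ?thesis using 1[of "y - p"] y by (auto split: if_splits)
    qed
  qed
  moreover have "?F \<subseteq> {1..<p+q}" "1 \<in> {1..p+q} - ?F" using c(1-3) e(1-3) by auto
  moreover have "\<tau> f = f" if "f \<in> ?F" for f
  proof -
    have "f = k + 1 \<and> c = k + 2 \<or> f = p + u \<and> e + 1 = u" using that by (auto split: if_splits)
    then show ?thesis using c(1-3) e(1-3) by (auto simp: \<tau>_def)
  qed
  moreover have "\<tau> i \<in> {1..p+q}" if "i \<in> {1..p+q}" for i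
    using that c(1-3) e(1-3) by (auto simp: \<tau>_def)
  moreover have "\<tau> i = i" if "i \<notin> {1..p+q}" for i
    using that c(1-3) e(1-3) by (cases "i = 0") (simp_all add: \<tau>_def)
  ultimately have "cycle_off (p + q) ?F \<tau>" by (blast intro: cycle_offI)
  moreover have "shape (insertion_tableau (p + q) \<tau>) = add_column q (replicate p 1)"
  proof -
    let ?A = "map \<tau> [1..<Suc p]" and ?B = "map \<tau> [Suc p..<Suc (p + q)]"
    have "[1..<Suc (p + q)] = [1..<Suc p] @ [Suc p..<Suc (p + q)]"
      using upt_add_eq_append[of 1 "Suc p" q] by simp
    moreover have "shape (rsk (?A @ ?B)) = add_column (length ?B) (replicate (length ?A) 1)"
    proof (rule shape_rsk_two_columns)
      show "sorted_wrt (>) ?A" "sorted_wrt (>) ?B"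
        using c(1-3) e(1-3) by (intro sorted_wrt_map_upt; auto simp: \<tau>_def)+
      show "length ?B \<le> length ?A" using \<open>q \<le> p\<close> by simp
      \<comment> \<open>For \<open>i = 0\<close> this is \<open>1 < c\<close>. For other
        \<open>i\<close> the letter of \<open>?B\<close> exceeds \<open>p\<close>, whereas in
        \<open>?A\<close> only \<open>p + e\<close> does; the latter is compared only if
        \<open>q = p\<close>, and then with \<open>p + q\<close>.\<close>
      show "rev ?A ! i < rev ?B ! i" if "i < length ?B" for i
      proof -
        have i: "i < q" using that by (simp del: upt_Suc)
        then have "rev ?A ! i = \<tau> (p - i)" "rev ?B ! i = \<tau> (p + q - i)"
          using \<open>q \<le> p\<close> by (simp_all add: rev_nth Suc_diff_Suc del: upt_Suc)
        moreover have "\<tau> (p - i) < \<tau> (p + q - i)"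
          using i c(1-3) e(1-3) \<open>q \<le> p\<close> by (auto simp: \<tau>_def)
        ultimately show ?thesis by simp
      qed
    qed
    ultimately show ?thesis unfolding insertion_tableau_eq_rsk by (simp del: upt_Suc)
  qed
  ultimately show ?thesis using that by blast
qed

section \<open>Increasing and decreasing subsequences\<close>

lemma length_tableau_insert: "length T \<le> length (tableau_insert a T)"
  by (induction T arbitrary: a) (auto split: prod.split option.split)

lemma rsk_Nil_iff: "rsk w = [] \<longleftrightarrow> w = []"
  using rsk_snoc tableau_insert_neq_Nil by (cases w rule: rev_cases) (auto simp: rsk_def)

lemma Nil_notin_tableau_insert: "[] \<notin> set T \<Longrightarrow> [] \<notin> set (tableau_insert a T)"
proof (induction T arbitrary: a)
  case (Cons r T)
  show ?case
  proof (cases rule: row_insert_cases[of r a])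
    case append
    then show ?thesis using tableau_insert_append[OF append, of T] Cons.prems by auto
  next
    case (bump u b v)
    then show ?thesis using tableau_insert_bump[OF bump(2,3), of v T] Cons by auto
  qed
qed simp

lemma Nil_notin_rsk: "[] \<notin> set (rsk w)"
  by (induction w rule: rev_induct) (simp_all add: rsk_snoc Nil_notin_tableau_insert, simp add: rsk_def)

lemma sorted_first_row: "rsk w = r # T \<Longrightarrow> sorted r"
proof (induction w arbitrary: r T rule: rev_induct)
  case (snoc a w)
  show ?case
  proof (cases "rsk w")
    case Nil
    then show ?thesis using snoc.prems by (auto simp: rsk_snoc)
  next
    case (Cons r' T')
    have "sorted r'" by (rule snoc.IH[OF Cons])
    then show ?thesis
    proof (cases rule: row_insert_cases[of r' a])
      case append
      then show ?thesis
        using snoc.prems Cons tableau_insert_append[OF append, of T'] \<open>sorted r'\<close>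
        by (auto simp: rsk_snoc sorted_append)
    next
      case (bump u b v)
      then show ?thesis
        using snoc.prems Cons tableau_insert_bump[OF bump(2,3), of v T'] \<open>sorted r'\<close>
        by (fastforce simp: rsk_snoc sorted_append)
    qed
  qed
qed (simp add: rsk_def)

lemma rsk_single_row: "rsk w = [r] \<Longrightarrow> w = r"
proof (induction w arbitrary: r rule: rev_induct)
  case (snoc a w)
  show ?case
  proof (cases "rsk w")
    case Nil
    then show ?thesis using snoc.prems by (simp add: rsk_Nil_iff) (simp add: rsk_def)
  next
    case (Cons r' T')
    then have "length (rsk w) \<le> length [r]"
      using snoc.prems length_tableau_insert by (metis rsk_snoc)
    then have T': "rsk w = [r']" using Cons by simp
    then have w: "w = r'" by (rule snoc.IH)
    show ?thesis
    proof (cases rule: row_insert_cases[of r' a])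
      case append
      then show ?thesis
        using snoc.prems T' w tableau_insert_append[OF append, of "[]"] by (simp add: rsk_snoc)
    next
      case (bump u b v)
      then show ?thesis
        using snoc.prems T' tableau_insert_bump[OF bump(2,3), of v "[]"] by (simp add: rsk_snoc)
    qed
  qed
qed (simp add: rsk_def)

text \<open>Only one bump can have happened, and one of the two letters involved is removed. The
  bound by the first row is the invariant for the induction: a letter appended later is at least
  every first-row entry, hence at least all of \<open>w1 @ w2\<close>.\<close>

lemma sorted_off_one_entry:
  assumes "shape (rsk w) = [m, 1]"
  shows "\<exists>w1 y w2. w = w1 @ y # w2 \<and> sorted (w1 @ w2)
    \<and> (\<forall>e\<in>set (w1 @ w2). \<exists>x\<in>set (hd (rsk w)). e \<le> x)"
  using assms
proof (induction w arbitrary: m rule: rev_induct)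
  case (snoc a w)
  have sh: "shape (tableau_insert a (rsk w)) = [m, 1]" using snoc.prems by (simp add: rsk_snoc)
  consider "rsk w = []" | r where "rsk w = [r]" | r1 r2 T where "rsk w = r1 # r2 # T"
    by (metis list.exhaust)
  then show ?case
  proof cases
    case 1
    then show ?thesis using sh by (simp add: shape_def)
  next
    case (2 r)
    then have r: "w = r" "sorted r" using rsk_single_row sorted_first_row by blast+
    show ?thesis
    proof (cases rule: row_insert_cases[of r a])
      case append
      then show ?thesis
        using sh 2 tableau_insert_append[OF append, of "[]"] by (simp add: shape_def)
    next
      case (bump u b v)
      have T: "rsk (w @ [a]) = [u @ a # v, [b]]"
        using 2 bump tableau_insert_bump[OF bump(2,3), of v "[]"] by (simp add: rsk_snoc)
      \<comment> \<open>If \<open>b\<close> was the last entry, \<open>b\<close> is removed, since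
        the new first row no longer bounds it. Otherwise \<open>a\<close> is removed, and the last
        entry of \<open>v\<close> still bounds \<open>w\<close>.\<close>
      show ?thesis
      proof (cases v)
        case Nil
        have "w @ [a] = u @ b # [a]" "sorted (u @ [a])" using r bump Nil by (auto simp: sorted_append)
        moreover have "\<forall>e\<in>set (u @ [a]). \<exists>x\<in>set (hd (rsk (w @ [a]))). e \<le> x" by (auto simp: T)
        ultimately show ?thesis by blast
      next
        case (Cons z v')
        have "w @ [a] = w @ a # []" "sorted (w @ [])" using r by simp_all
        moreover have "\<forall>e\<in>set (w @ []). \<exists>x\<in>set (hd (rsk (w @ [a]))). e \<le> x"
          unfolding T list.sel using r bump(1) Cons by (auto simp: sorted_append)
        ultimately show ?thesis by blast
      qed
    qed
  next
    case (3 r1 r2 T)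
    show ?thesis
    proof (cases rule: row_insert_cases[of r1 a])
      case append
      have T': "rsk (w @ [a]) = (r1 @ [a]) # r2 # T"
        using 3 tableau_insert_append[OF append, of "r2 # T"] by (simp add: rsk_snoc)
      then have "shape (rsk w) = [m - 1, 1]" using snoc.prems 3 by (auto simp: shape_def)
      from snoc.IH[OF this] obtain w1 y w2 where w: "w = w1 @ y # w2" "sorted (w1 @ w2)"
        and le: "\<forall>e\<in>set (w1 @ w2). \<exists>x\<in>set r1. e \<le> x" unfolding 3 list.sel by blast
      have "\<forall>e\<in>set (w1 @ w2). e \<le> a" using le append by (meson order.trans)
      then have "sorted (w1 @ w2 @ [a])" using w(2) by (auto simp: sorted_append)
      moreover have "\<forall>e\<in>set (w1 @ w2 @ [a]). \<exists>x\<in>set (hd (rsk (w @ [a]))). e \<le> x"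
        using \<open>\<forall>e\<in>set (w1 @ w2). e \<le> a\<close> by (auto simp: T')
      moreover have "w @ [a] = w1 @ y # (w2 @ [a])" using w(1) by simp
      ultimately show ?thesis by blast
    next
      case (bump u b v)
      have "tableau_insert a (rsk w) = (u @ a # v) # tableau_insert b (r2 # T)"
        unfolding 3 bump(1) by (rule tableau_insert_bump[OF bump(2,3)])
      then have sh2: "shape (tableau_insert b (r2 # T)) = [1]" using sh by (simp add: shape_def)
      have "r2 \<noteq> []" using Nil_notin_rsk[of w] 3 by auto
      \<comment> \<open>A second bump would lengthen the second row or create a third one.\<close>
      then have False
      proof (cases rule: row_insert_cases[of r2 b])
        case append
        then show ?thesis
          using sh2 tableau_insert_append[OF append, of T] \<open>r2 \<noteq> []\<close> by (simp add: shape_def)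
      next
        case (bump u b' v)
        then show ?thesis
          using sh2 tableau_insert_bump[OF bump(2,3), of v T] tableau_insert_neq_Nil
          by (simp add: shape_def)
      qed
      then show ?thesis ..
    qed
  qed
qed (simp add: rsk_def shape_def)

text \<open>The second conjunct excludes decreasing triples; the first is the invariant behind it. A
  letter preceded by a larger one stays in the first row with a larger letter below, and this forces
  every later letter to be at least as large.\<close>

lemma two_rows_inversions:
  assumes "length (rsk w) \<le> 2"
  shows "(\<forall>i j. i < j \<and> j < length w \<and> w ! j < w ! i \<longrightarrow>
      w ! j \<in> set (hd (rsk w)) \<and> (\<exists>e\<in>\<Union>(set ` set (tl (rsk w))). w ! j < e)) \<and>
    (\<forall>i j k. i < j \<and> j < k \<and> k < length w \<and> w ! j < w ! i \<longrightarrow> w ! j \<le> w ! k)"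
  using assms
proof (induction w rule: rev_induct)
  case (snoc a w)
  let ?T = "rsk (w @ [a])"
  have len: "length (rsk w) \<le> 2"
    using snoc.prems length_tableau_insert[of "rsk w" a] by (simp add: rsk_snoc)
  note IH = snoc.IH[OF len]
  have old: "w ! j \<le> a \<and> w ! j \<in> set (hd ?T) \<and> (\<exists>e\<in>\<Union>(set ` set (tl ?T)). w ! j < e)"
    if ij: "i < j" "j < length w" "w ! j < w ! i" for i j
  proof -
    obtain r R where T: "rsk w = r # R"
      using ij(2) rsk_Nil_iff[of w] by (cases "rsk w") auto
    have j: "w ! j \<in> set r" "\<exists>e\<in>\<Union>(set ` set R). w ! j < e" using IH ij by (auto simp: T)
    show ?thesis
    proof (cases rule: row_insert_cases[of r a])
      case append
      have "?T = (r @ [a]) # R" using T tableau_insert_append[OF append] by (simp add: rsk_snoc)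
      then show ?thesis using j append by simp
    next
      case (bump u y v)
      have T': "?T = (u @ a # v) # tableau_insert y R"
        using T bump tableau_insert_bump by (simp add: rsk_snoc)
      \<comment> \<open>As no third row arises, \<open>y\<close> is appended to the second row and
        so bounds it. Hence \<open>w ! j < y\<close>, so \<open>w ! j\<close> stands left of the
        place where \<open>a\<close> lands.\<close>
      have "\<forall>e\<in>\<Union>(set ` set R). e \<le> y"
      proof (cases R)
        case (Cons r2 R')
        then have R: "R = [r2]" using len by (simp add: T)
        show ?thesis
        proof (cases rule: row_insert_cases[of r2 y])
          case (bump u' y' v')
          then show ?thesis
            using snoc.prems T' R tableau_insert_bump[OF bump(2,3), of v' "[]"] by simp
        qed (use R in simp)
      qed simp
      then obtain e where e: "e \<in> \<Union>(set ` set R)" "w ! j < e" "e \<le> y" using j(2) by blast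
      have "sorted (u @ y # v)" using sorted_first_row[OF T] bump(1) by simp
      then have "w ! j \<in> set u" using j(1) e(2,3) bump(1) by (auto simp: sorted_append)
      moreover have "e \<in> \<Union>(set ` set (tl ?T))" using e(1) set_tableau_insert[of y R] by (simp add: T')
      ultimately show ?thesis using bump(2) e(2) unfolding T' by auto
    qed
  qed
  have new: "a \<in> set (hd ?T) \<and> (\<exists>e\<in>\<Union>(set ` set (tl ?T)). a < e)"
    if i: "i < length w" "a < w ! i" for i
  proof -
    obtain r R where T: "rsk w = r # R"
      using i(1) rsk_Nil_iff[of w] by (cases "rsk w") auto
    have wi: "w ! i \<in> set r \<union> \<Union>(set ` set R)" using set_rsk[of w] i(1) by (simp add: T)
    show ?thesis
    proof (cases rule: row_insert_cases[of r a])
      case append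
      have "?T = (r @ [a]) # R" using T tableau_insert_append[OF append] by (simp add: rsk_snoc)
      then show ?thesis using wi i(2) append by auto
    next
      case (bump u y v)
      have T': "?T = (u @ a # v) # tableau_insert y R"
        using T bump tableau_insert_bump by (simp add: rsk_snoc)
      have "y \<in> \<Union>(set ` set (tl ?T))" using set_tableau_insert[of y R] by (simp add: T')
      then show ?thesis using bump(3) unfolding T' by auto
    qed
  qed
  show ?case
  proof (intro conjI allI impI)
    fix i j assume ij: "i < j \<and> j < length (w @ [a]) \<and> (w @ [a]) ! j < (w @ [a]) ! i"
    show "(w @ [a]) ! j \<in> set (hd ?T)" "\<exists>e\<in>\<Union>(set ` set (tl ?T)). (w @ [a]) ! j < e"
      using ij old[of i j] new[of i] by (cases "j = length w"; auto simp: nth_append)+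
  next
    fix i j k
    assume "i < j \<and> j < k \<and> k < length (w @ [a]) \<and> (w @ [a]) ! j < (w @ [a]) ! i"
    then show "(w @ [a]) ! j \<le> (w @ [a]) ! k"
      using IH old[of i j] by (cases "k = length w") (auto simp: nth_append)
  qed
qed simp

lemma hd_tableau_insert: "T \<noteq> [] \<Longrightarrow> hd (tableau_insert a T) = fst (row_insert a (hd T))"
  by (cases T) (auto split: prod.split option.split)

lemma row_insert_nth:
  assumes "sorted r"
  shows "length r \<le> length (fst (row_insert a r))"
    and "k < length r \<Longrightarrow> fst (row_insert a r) ! k \<le> r ! k"
    and "k = 0 \<or> k \<le> length r \<and> r ! (k - 1) < a
      \<Longrightarrow> k < length (fst (row_insert a r)) \<and> fst (row_insert a r) ! k \<le> a"
proof (atomize (full), cases rule: row_insert_cases[of r a])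
  case append
  then show "length r \<le> length (fst (row_insert a r)) \<and>
    (k < length r \<longrightarrow> fst (row_insert a r) ! k \<le> r ! k) \<and>
    (k = 0 \<or> k \<le> length r \<and> r ! (k - 1) < a \<longrightarrow>
      k < length (fst (row_insert a r)) \<and> fst (row_insert a r) ! k \<le> a)"
    by (auto simp: row_insert_append nth_append)
next
  case (bump u b v)
  have ins: "fst (row_insert a r) = u @ a # v" using bump by (simp add: row_insert_bump)
  \<comment> \<open>The letter \<open>a\<close> lands at index \<open>length u\<close>, and from
    there on the old entries exceed \<open>a\<close>.\<close>
  have "k \<le> length u" if "k = 0 \<or> k \<le> length r \<and> r ! (k - 1) < a"
  proof (rule ccontr)
    assume "\<not> k \<le> length u"
    then have "length u \<le> k - 1" "k - 1 < length r" "k \<noteq> 0" using that by auto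
    then have "r ! length u \<le> r ! (k - 1)" using assms by (intro sorted_nth_mono)
    then show False using that \<open>k \<noteq> 0\<close> bump(1,3) by simp
  qed
  then show "length r \<le> length (fst (row_insert a r)) \<and>
    (k < length r \<longrightarrow> fst (row_insert a r) ! k \<le> r ! k) \<and>
    (k = 0 \<or> k \<le> length r \<and> r ! (k - 1) < a \<longrightarrow>
      k < length (fst (row_insert a r)) \<and> fst (row_insert a r) ! k \<le> a)"
    unfolding ins using bump by (auto simp: nth_append nth_Cons' le_less)
qed

text \<open>Schensted's bound. The second conjunct carries the induction: if \<open>a\<close>
  extends a subsequence of length \<open>k\<close>, then entry \<open>k - 1\<close> of the first row
  is below \<open>a\<close>, so \<open>a\<close> lands at index \<open>k\<close> or further right.
  Later insertions never raise an entry.\<close>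

lemma increasing_le_first_row:
  assumes "S \<subseteq> {..<length w}" "strict_mono_on S (\<lambda>i. w ! i)" "S \<noteq> {}"
  shows "card S \<le> length (hd (rsk w)) \<and> hd (rsk w) ! (card S - 1) \<le> w ! Max S"
  using assms
proof (induction w arbitrary: S rule: rev_induct)
  case (snoc a w)
  \<comment> \<open>The empty tableau has no first row; the empty list stands in, so that every
    insertion acts on some row.\<close>
  define r where "r = (if w = [] then [] else hd (rsk w))"
  define r' where "r' = hd (rsk (w @ [a]))"
  have r': "r' = fst (row_insert a r)"
    using hd_tableau_insert[of "rsk w" a] rsk_Nil_iff[of w]
    by (cases "w = []") (simp_all add: r_def r'_def rsk_snoc, simp add: rsk_def)
  have r: "sorted r"
    using sorted_first_row[of w "hd (rsk w)" "tl (rsk w)"] rsk_Nil_iff[of w] by (simp add: r_def)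
  note row = row_insert_nth[OF r, where a = a, folded r']
  have IH: "card S \<le> length r \<and> r ! (card S - 1) \<le> w ! Max S"
    if "S \<subseteq> {..<length w}" "strict_mono_on S (\<lambda>i. (w @ [a]) ! i)" "S \<noteq> {}" for S
  proof -
    have "strict_mono_on S (\<lambda>i. w ! i)"
      using that(1,2) by (auto simp: strict_mono_on_def nth_append subset_iff)
    moreover have "w \<noteq> []" using that(1,3) by auto
    ultimately show ?thesis using snoc.IH[OF that(1) _ that(3)] by (simp add: r_def)
  qed
  have fin: "finite S" using snoc.prems(1) finite_subset by blast
  show ?case
  proof (cases "length w \<in> S")
    case False
    then have S: "S \<subseteq> {..<length w}" using snoc.prems(1) by (auto simp: less_Suc_eq)
    have "Max S < length w" using S fin snoc.prems(3) by auto
    moreover have "card S \<noteq> 0" using fin snoc.prems(3) by simp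
    then have "card S - 1 < length r" using IH[OF S snoc.prems(2,3)] by linarith
    then have "r' ! (card S - 1) \<le> w ! Max S"
      using row(2) IH[OF S snoc.prems(2,3)] order.trans by blast
    ultimately show ?thesis
      using IH[OF S snoc.prems(2,3)] row(1) by (fold r'_def) (simp add: nth_append)
  next
    case True
    let ?S = "S - {length w}"
    have S: "?S \<subseteq> {..<length w}" using snoc.prems(1) by (auto simp: less_Suc_eq)
    have mono: "strict_mono_on ?S (\<lambda>i. (w @ [a]) ! i)"
      using snoc.prems(2) by (auto simp: strict_mono_on_def)
    have card: "card S = Suc (card ?S)" using fin True by (rule card.remove)
    have Max: "Max S = length w"
      using True fin snoc.prems(1) by (intro Max_eqI) (auto simp: less_Suc_eq_le)
    have "card ?S = 0 \<or> card ?S \<le> length r \<and> r ! (card ?S - 1) < a"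
    proof (cases "?S = {}")
      case True
      then show ?thesis by (simp only: card.empty simp_thms)
    next
      case False
      have "Max ?S \<in> ?S" using False fin by (intro Max_in) auto
      then have "Max ?S < length w" "Max ?S \<in> S" using S by auto
      then have "(w @ [a]) ! Max ?S < (w @ [a]) ! length w"
        using snoc.prems(2) True unfolding strict_mono_on_def by blast
      then have "w ! Max ?S < a" using \<open>Max ?S < length w\<close> by (simp add: nth_append)
      then show ?thesis using IH[OF S mono False] by auto
    qed
    from row(3)[OF this] show ?thesis by (fold r'_def) (simp add: card Max nth_append)
  qed
qed simp

section \<open>Fixed points and orbits of permutations with two-row shapes\<close>

lemma no_decreasing_triple:
  assumes "length (insertion_tableau n \<sigma>) \<le> 2" "inj \<sigma>"
    and "1 \<le> i" "i < j" "j < k" "k \<le> n" "\<sigma> j < \<sigma> i"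
  shows "\<sigma> j < \<sigma> k"
proof -
  let ?w = "map \<sigma> [1..<Suc n]"
  have "\<forall>i j k. i < j \<and> j < k \<and> k < length ?w \<and> ?w ! j < ?w ! i \<longrightarrow> ?w ! j \<le> ?w ! k"
    using two_rows_inversions[of ?w] assms(1) unfolding insertion_tableau_eq_rsk by blast
  moreover have "i - 1 < j - 1" "j - 1 < k - 1" "k - 1 < length ?w" "?w ! (j - 1) < ?w ! (i - 1)"
    using assms(3-7) by (auto simp del: upt_Suc)
  ultimately have "?w ! (j - 1) \<le> ?w ! (k - 1)" by blast
  then have "\<sigma> j \<le> \<sigma> k" using assms(3-6) by (simp del: upt_Suc)
  moreover have "\<sigma> j \<noteq> \<sigma> k" using assms(2,5) by (simp add: inj_eq)
  ultimately show ?thesis by simp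
qed

lemma card_increasing_le:
  assumes "shape (insertion_tableau n \<sigma>) = l # ls" "S \<subseteq> {1..n}" "strict_mono_on S \<sigma>"
  shows "card S \<le> l"
proof (cases "S = {}")
  case False
  let ?S = "(\<lambda>i. i - 1) ` S"
  have "i - 1 < n" if "i \<in> S" for i using subsetD[OF assms(2) that] by auto
  then have "?S \<subseteq> {..<length (map \<sigma> [1..<Suc n])}" by (auto simp del: upt_Suc)
  moreover have "strict_mono_on ?S (\<lambda>i. map \<sigma> [1..<Suc n] ! i)"
  proof (rule strict_mono_onI)
    fix x y assume "x \<in> ?S" "y \<in> ?S" "x < y"
    then obtain i k where ik: "x = i - 1" "y = k - 1" "i \<in> S" "k \<in> S" "i < k" by auto
    then have "i \<in> {1..n}" "k \<in> {1..n}" "\<sigma> i < \<sigma> k"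
      using assms(2,3) by (auto simp: strict_mono_on_def)
    moreover from this have "i - 1 < n" "k - 1 < n" by auto
    ultimately show "map \<sigma> [1..<Suc n] ! x < map \<sigma> [1..<Suc n] ! y"
      unfolding ik by (auto simp del: upt_Suc)
  qed
  ultimately have "card ?S \<le> length (hd (rsk (map \<sigma> [1..<Suc n])))"
    using increasing_le_first_row False by blast
  moreover have "length (hd (rsk (map \<sigma> [1..<Suc n]))) = l"
    using assms(1) by (auto simp: insertion_tableau_eq_rsk shape_def)
  moreover have "card ?S = card S" 
  proof (intro card_image inj_onI)
    fix x y assume xy: "x \<in> S" "y \<in> S" "x - 1 = y - 1"
    then have "x \<in> {1..n}" "y \<in> {1..n}" using assms(2) by auto
    then show "x = y" using xy(3) by auto
  qed
  ultimately show ?thesis by simp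
qed simp

text \<open>Two increasing sequences of length at most \<open>l\<close> cover \<open>{1..n}\<close>.
  Fixed points turn out to be left-to-right maxima and are also put into the other sequence;
  counting them twice gives the left side.\<close>

lemma card_fixed_points_le:
  assumes perm: "\<sigma> permutes {1..n}" and sh: "shape (insertion_tableau n \<sigma>) = [l, m]"
  shows "n + card {i \<in> {1..n}. \<sigma> i = i} \<le> 2 * l"
proof -
  let ?F = "{i \<in> {1..n}. \<sigma> i = i}"
  define L where "L = {i \<in> {1..n}. \<forall>h \<in> {1..<i}. \<sigma> h < \<sigma> i}"
  have len: "length (insertion_tableau n \<sigma>) \<le> 2"
    using arg_cong[OF sh, of length] by (simp add: shape_def)
  have inj: "inj \<sigma>" using perm by (rule permutes_inj)
  have triple: "\<sigma> j < \<sigma> k" if "1 \<le> i" "i < j" "j < k" "k \<le> n" "\<sigma> j < \<sigma> i" for i j k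
    using no_decreasing_triple[OF len inj that] .
  \<comment> \<open>If a larger value stood before the fixed point \<open>f\<close>, then counting
    the values below \<open>f\<close> would put one of them behind \<open>f\<close>, and a
    decreasing triple with middle \<open>f\<close> would arise.\<close>
  have before: "\<sigma> i < f" if f: "f \<in> ?F" and i: "1 \<le> i" "i < f" for i f
  proof (rule ccontr)
    assume "\<not> \<sigma> i < f"
    moreover have "\<sigma> i \<noteq> \<sigma> f" using inj i by (simp add: inj_eq)
    ultimately have gt: "\<sigma> f < \<sigma> i" using f by auto
    have "\<sigma> i \<in> \<sigma> ` {1..<f}" "\<sigma> i \<notin> {1..<f}" using i gt f by auto
    then have "\<not> \<sigma> ` {1..<f} \<subseteq> {1..<f}" by blast
    moreover have "\<exists>k\<in>{f<..n}. \<sigma> k < f"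
    proof (rule ccontr)
      assume none: "\<not> (\<exists>k\<in>{f<..n}. \<sigma> k < f)"
      have "{1..<f} \<subseteq> \<sigma> ` {1..<f}"
      proof
        fix v assume v: "v \<in> {1..<f}"
        then have "v \<in> {1..n}" using f by auto
        then obtain k where k: "k \<in> {1..n}" "\<sigma> k = v"
          using permutes_image[OF perm] by (metis imageE)
        then have "k < f" using none v f by (metis (mono_tags, lifting) atLeastAtMost_iff
              atLeastLessThan_iff greaterThanAtMost_iff linorder_neqE_nat mem_Collect_eq nat_less_le)
        then show "v \<in> \<sigma> ` {1..<f}" using k by auto
      qed
      moreover have "card (\<sigma> ` {1..<f}) = card {1..<f}"
        using inj by (intro card_image) (auto simp: inj_on_def)
      ultimately have "\<sigma> ` {1..<f} = {1..<f}" by (metis card_subset_eq finite_atLeastLessThan finite_imageI)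
      then show False using \<open>\<not> \<sigma> ` {1..<f} \<subseteq> {1..<f}\<close> by simp
    qed
    then obtain k where "f < k" "k \<le> n" "\<sigma> k < f" by auto
    then show False using triple[OF i _ _ gt, of k] f by simp
  qed
  \<comment> \<open>By \<open>before\<close>, \<open>\<sigma>\<close> maps \<open>{1..<f}\<close>
    onto itself, so no value below \<open>f\<close> is left for later positions.\<close>
  have after: "f < \<sigma> k" if f: "f \<in> ?F" and k: "f < k" "k \<le> n" for f k
  proof (rule ccontr)
    assume "\<not> f < \<sigma> k"
    moreover have "\<sigma> k \<noteq> \<sigma> f" using inj k by (simp add: inj_eq)
    ultimately have "\<sigma> k < f" using f by auto
    then have *: "\<sigma> k \<in> {1..<f}"
      using perm k f permutes_in_image[OF perm, of k] by auto
    have "\<sigma> ` {1..<f} \<subseteq> {1..<f}"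
    proof
      fix v assume "v \<in> \<sigma> ` {1..<f}"
      then obtain i where i: "v = \<sigma> i" "1 \<le> i" "i < f" by auto
      then have "\<sigma> i \<in> {1..n}" using permutes_in_image[OF perm, of i] f by auto
      then show "v \<in> {1..<f}" using i before[OF f] by auto
    qed
    moreover have "card (\<sigma> ` {1..<f}) = card {1..<f}"
      using inj by (intro card_image) (auto simp: inj_on_def)
    ultimately have "\<sigma> ` {1..<f} = {1..<f}" by (metis card_subset_eq finite_atLeastLessThan)
    then obtain i where "i < f" "\<sigma> k = \<sigma> i" using * by (metis atLeastLessThan_iff imageE)
    then show False using inj k by (simp add: inj_eq)
  qed
  have "strict_mono_on L \<sigma>" by (intro strict_mono_onI) (auto simp: L_def)
  then have "card L \<le> l" by (intro card_increasing_le[OF sh]) (auto simp: L_def)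
  moreover have "card (({1..n} - L) \<union> ?F) \<le> l"
  proof (rule card_increasing_le[OF sh])
    show "strict_mono_on ({1..n} - L \<union> ?F) \<sigma>"
    proof (rule strict_mono_onI)
      fix i k assume ik: "i \<in> {1..n} - L \<union> ?F" "k \<in> {1..n} - L \<union> ?F" "i < k"
      show "\<sigma> i < \<sigma> k"
      proof (cases "i \<in> ?F \<or> k \<in> ?F")
        case True
        then show ?thesis using before[of k i] after[of i k] ik by auto
      next
        case False
        \<comment> \<open>Outside \<open>L\<close> some earlier value is larger, so a descent from
          \<open>i\<close> to \<open>k\<close> would complete a decreasing triple.\<close>
        then obtain h where h: "1 \<le> h" "h < i" "\<not> \<sigma> h < \<sigma> i" using ik by (auto simp: L_def)
        moreover have "\<sigma> h \<noteq> \<sigma> i" using inj h(2) by (simp add: inj_eq)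
        ultimately show ?thesis using triple[of h i k] ik by auto
      qed
    qed
  qed auto
  moreover have "card (({1..n} - L) \<union> ?F) = (n - card L) + card ?F"
  proof -
    have "?F \<subseteq> L" using before by (auto simp: L_def)
    then have "({1..n} - L) \<inter> ?F = {}" by blast
    moreover have "L \<subseteq> {1..n}" by (auto simp: L_def)
    ultimately show ?thesis by (subst card_Un_disjoint) (auto simp: card_Diff_subset finite_subset)
  qed
  ultimately show ?thesis by linarith
qed

text \<open>The cycle type determines the number of fixed points; this transfers a bound between two
  permutations of equal type but different shapes.\<close>

lemma count_cycle_type:
  assumes "\<sigma> permutes {1..n}"
  shows "count (mset (cycle_type n \<sigma>)) 1 = card {i \<in> {1..n}. \<sigma> i = i}"
proof -
  let ?O = "orbit \<sigma> ` {1..n}"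
  have perm: "permutation \<sigma>" using assms by (auto simp: permutation_permutes)
  have "{S \<in> ?O. card S = 1} = (\<lambda>i. {i}) ` {i \<in> {1..n}. \<sigma> i = i}"
  proof (intro equalityI subsetI)
    fix S assume "S \<in> {S \<in> ?O. card S = 1}"
    then obtain i x where i: "i \<in> {1..n}" "S = orbit \<sigma> i" "S = {x}"
      by (auto simp: card_1_singleton_iff)
    have "i \<in> {x}" using permutation_self_in_orbit[OF perm, of i] unfolding i(2)[symmetric] i(3) .
    then have "x = i" by simp
    then have "orbit \<sigma> i = {i}" using i(2,3) by simp
    then have "\<sigma> i = i" "S = {i}" using i(2) by (simp_all only: orbit_eq_singleton_iff)
    then show "S \<in> (\<lambda>i. {i}) ` {i \<in> {1..n}. \<sigma> i = i}" using i(1) by blast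
  next
    fix S assume "S \<in> (\<lambda>i. {i}) ` {i \<in> {1..n}. \<sigma> i = i}"
    then obtain i where "i \<in> {1..n}" "\<sigma> i = i" "S = {i}" by auto
    then show "S \<in> {S \<in> ?O. card S = 1}"
      using orbit_eq_singleton_iff[of \<sigma> i] by (auto simp: image_iff intro!: bexI[of _ i])
  qed
  then have "card {S \<in> ?O. card S = 1} = card {i \<in> {1..n}. \<sigma> i = i}"
    by (simp add: card_image)
  then show ?thesis
    by (simp add: cycle_type_def count_conv_size_mset filter_mset_image_mset)
qed

lemma increasing_off_one_point:
  assumes "shape (insertion_tableau n \<sigma>) = [m, 1]" "inj \<sigma>"
  obtains p where "p \<in> {1..n}" "strict_mono_on ({1..n} - {p}) \<sigma>"
proof -
  let ?w = "map \<sigma> [1..<Suc n]"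
  obtain w1 y w2 where w: "?w = w1 @ y # w2" "sorted (w1 @ w2)"
    using sorted_off_one_entry[of ?w m] assms(1) unfolding insertion_tableau_eq_rsk by blast
  have len: "length w1 + length w2 + 1 = n" using arg_cong[OF w(1), of length] by (simp del: upt_Suc)
  have le: "?w ! i \<le> ?w ! k" if "i < k" "k < n" "i \<noteq> length w1" "k \<noteq> length w1" for i k
  proof -
    \<comment> \<open>\<open>g\<close> renumbers the positions after the letter at index
      \<open>length w1\<close> has been deleted.\<close>
    define g where "g i = (if i < length w1 then i else i - 1)" for i
    have g: "?w ! i = (w1 @ w2) ! g i" if "i < n" "i \<noteq> length w1" for i
      unfolding w(1) using that by (auto simp: g_def nth_append nth_Cons')
    have "(w1 @ w2) ! g i \<le> (w1 @ w2) ! g k"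
      using that len by (intro sorted_nth_mono[OF w(2)]) (auto simp: g_def)
    then show ?thesis using g that by simp
  qed
  have "strict_mono_on ({1..n} - {length w1 + 1}) \<sigma>"
  proof (rule strict_mono_onI)
    fix i k assume ik: "i \<in> {1..n} - {length w1 + 1}" "k \<in> {1..n} - {length w1 + 1}" "i < k"
    then have "?w ! (i - 1) \<le> ?w ! (k - 1)" by (intro le) auto
    moreover have "?w ! (i - 1) = \<sigma> i" "?w ! (k - 1) = \<sigma> k"
      using ik by (auto simp del: upt_Suc)
    moreover have "\<sigma> i \<noteq> \<sigma> k" using assms(2) ik(3) by (simp add: inj_eq)
    ultimately show "\<sigma> i < \<sigma> k" by simp
  qed
  moreover have "length w1 + 1 \<in> {1..n}" using len by simp
  ultimately show ?thesis using that by blast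
qed

text \<open>Off \<open>p\<close> the map preserves order and skips only the value
  \<open>\<sigma> p\<close>, so each point is fixed or moves by one towards \<open>p\<close>, and it
  goes on moving until it arrives there.\<close>

lemma orbit_increasing_off_one_point:
  fixes \<sigma> :: "nat \<Rightarrow> nat"
  assumes perm: "\<sigma> permutes {1..n}" and p: "p \<in> {1..n}"
    and mono: "strict_mono_on ({1..n} - {p}) \<sigma>"
    and i: "i \<in> {1..n}" "\<sigma> i \<noteq> i"
  shows "p \<in> orbit \<sigma> i"
proof -
  have inj: "inj \<sigma>" using perm by (rule permutes_inj)
  have in_range: "\<sigma> i \<in> {1..n}" if "i \<in> {1..n}" for i
    using permutes_in_image[OF perm] that by blast
  have mono_off: "\<sigma> i < \<sigma> k" if "i \<in> {1..n} - {p}" "k \<in> {1..n} - {p}" "i < k" for i k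
    using mono that by (auto simp: strict_mono_on_def)
  \<comment> \<open>Both sides come from counting the points with value at most
    \<open>\<sigma> i\<close>: there are \<open>\<sigma> i\<close> of them, namely
    \<open>{1..i} - {p}\<close> and possibly \<open>p\<close>.\<close>
  have rank: "\<sigma> i + (if p \<le> i then 1 else 0) = i + (if \<sigma> p < \<sigma> i then 1 else 0)"
    if i: "i \<in> {1..n} - {p}" for i
  proof -
    let ?A = "{j \<in> {1..n}. \<sigma> j \<le> \<sigma> i}"
    have image: "\<sigma> ` ?A = {1..\<sigma> i}"
    proof (intro equalityI subsetI)
      fix v assume v: "v \<in> {1..\<sigma> i}"
      then have "v \<in> {1..n}" using in_range[of i] i by auto
      then obtain k where "k \<in> {1..n}" "\<sigma> k = v" using permutes_image[OF perm] by (metis imageE)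
      then show "v \<in> \<sigma> ` ?A" using v by auto
    qed (use in_range in auto)
    have "inj_on \<sigma> ?A" using inj by (rule inj_on_subset) simp
    from card_image[OF this] have "card ?A = \<sigma> i" unfolding image by simp
    moreover have "?A = ({1..i} - {p}) \<union> (if \<sigma> p < \<sigma> i then {p} else {})"
    proof (intro set_eqI)
      fix j
      have "\<sigma> p \<noteq> \<sigma> i" using inj i by (auto simp: inj_eq)
      moreover have "\<sigma> j \<le> \<sigma> i \<longleftrightarrow> j \<le> i" if "j \<in> {1..n} - {p}"
        using mono_off[of j i] mono_off[of i j] that i by (cases i j rule: linorder_cases) auto
      ultimately show "j \<in> ?A \<longleftrightarrow> j \<in> ({1..i} - {p}) \<union> (if \<sigma> p < \<sigma> i then {p} else {})"
        using i p by (cases "j = p") (auto simp: order_less_le)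
    qed
    moreover have "card (({1..i} - {p}) \<union> (if \<sigma> p < \<sigma> i then {p} else {}))
        = card ({1..i} - {p}) + (if \<sigma> p < \<sigma> i then 1 else 0)"
      by (subst card_Un_disjoint) auto
    moreover have "card ({1..i} - {p}) + (if p \<le> i then 1 else 0) = i"
      using p by (cases "p \<le> i") (auto simp: card_Diff_singleton)
    ultimately show ?thesis by simp
  qed
  \<comment> \<open>Here \<open>rank\<close> gives \<open>\<sigma> i = i + 1\<close>, and the
    condition \<open>\<sigma> p < \<sigma> i\<close> persists since the values grow along the
    way.\<close>
  have up: "p \<in> orbit \<sigma> i" if "i \<in> {1..n}" "i < p" "\<sigma> p < \<sigma> i" for i
    using that
  proof (induction "p - i" arbitrary: i rule: less_induct)
    case less
    have \<sigma>: "\<sigma> i = i + 1" using rank[of i] less.prems by simp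
    show ?case
    proof (cases "i + 1 = p")
      case True
      then show ?thesis using orbit.base[of \<sigma> i] \<sigma> by simp
    next
      case False
      then have i': "i + 1 \<in> {1..n}" "i + 1 < p" using less.prems p by auto
      then have "\<sigma> i < \<sigma> (i + 1)" using less.prems by (intro mono_off) auto
      then have "\<sigma> p < \<sigma> (i + 1)" using less.prems(3) by simp
      then have "p \<in> orbit \<sigma> (\<sigma> i)" using less.hyps[of "i + 1"] i' less.prems \<sigma> by simp
      then show ?thesis by (rule orbit_subset)
    qed
  qed
  have down: "p \<in> orbit \<sigma> i" if "i \<in> {1..n}" "p < i" "\<sigma> i < \<sigma> p" for i
    using that
  proof (induction i rule: less_induct)
    case (less i)
    have \<sigma>: "\<sigma> i = i - 1" using rank[of i] less.prems by simp
    show ?case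
    proof (cases "i - 1 = p")
      case True
      then show ?thesis using orbit.base[of \<sigma> i] \<sigma> by simp
    next
      case False
      then have i': "i - 1 \<in> {1..n}" "p < i - 1" using less.prems p by auto
      then have "\<sigma> (i - 1) < \<sigma> i" using less.prems by (intro mono_off) auto
      then have "\<sigma> (i - 1) < \<sigma> p" using less.prems(3) by simp
      then have "p \<in> orbit \<sigma> (\<sigma> i)" using less.IH[of "i - 1"] i' less.prems \<sigma> by simp
      then show ?thesis by (rule orbit_subset)
    qed
  qed
  have "permutation \<sigma>" using perm by (auto simp: permutation_permutes)
  then have self: "p \<in> orbit \<sigma> p" by (rule permutation_self_in_orbit)
  have "\<sigma> i \<noteq> \<sigma> p" if "i \<noteq> p" using inj that by (simp add: inj_eq)
  then consider "i = p" | "i < p" "\<sigma> p < \<sigma> i" | "p < i" "\<sigma> i < \<sigma> p"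
    using rank[of i] i by (cases i p rule: linorder_cases) (auto split: if_splits)
  then show ?thesis using self up down i(1) by cases auto
qed

section \<open>Realising all shapes\<close>

text \<open>Removing the second column rather than the first keeps the number of rows, so a shape
  with at least two rows remains one.\<close>

definition drop_second_column :: "nat list \<Rightarrow> nat list" where
  "drop_second_column \<nu> = map (\<lambda>x. if 2 \<le> x then x - 1 else x) \<nu>"

lemma add_column_drop_second_column:
  assumes "sorted_wrt (\<ge>) \<nu>" "\<forall>x\<in>set \<nu>. 0 < x"
  shows "add_column (length (filter (\<lambda>x. 2 \<le> x) \<nu>)) (drop_second_column \<nu>) = \<nu>"
  using assms
proof (induction \<nu>)
  case (Cons x \<nu>)
  show ?case
  proof (cases "2 \<le> x")
    case True
    then show ?thesis using Cons by (simp add: drop_second_column_def)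
  next
    case False
    then have "\<not> 2 \<le> y" if "y \<in> set (x # \<nu>)" for y using Cons.prems that by auto
    then have "filter (\<lambda>x. 2 \<le> x) (x # \<nu>) = []" "drop_second_column (x # \<nu>) = x # \<nu>"
      unfolding drop_second_column_def by (auto simp: filter_empty_conv intro!: map_idI)
    then show ?thesis by simp
  qed
qed (simp add: drop_second_column_def)

lemma is_partition_drop_second_column:
  assumes "is_partition n \<nu>"
  shows "is_partition (n - length (filter (\<lambda>x. 2 \<le> x) \<nu>)) (drop_second_column \<nu>)"
    and "length (filter (\<lambda>x. 2 \<le> x) \<nu>) \<le> n"
proof -
  let ?h = "length (filter (\<lambda>x. 2 \<le> x) \<nu>)"
  have \<nu>: "sorted_wrt (\<ge>) \<nu>" "\<forall>x\<in>set \<nu>. 0 < x" "sum_list \<nu> = n"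
    using assms unfolding is_partition_def by blast+
  have "sum_list \<mu> = sum_list (drop_second_column \<mu>) + length (filter (\<lambda>x. 2 \<le> x) \<mu>)" for \<mu>
    by (induction \<mu>) (auto simp: drop_second_column_def)
  from this[of \<nu>] have sum: "n = sum_list (drop_second_column \<nu>) + ?h" unfolding \<nu>(3) .
  then show "?h \<le> n" by simp
  have "sorted_wrt (\<ge>) (drop_second_column \<nu>)"
    unfolding drop_second_column_def sorted_wrt_map by (rule sorted_wrt_mono_rel[OF _ \<nu>(1)]) auto
  moreover have "\<forall>x\<in>set (drop_second_column \<nu>). 0 < x"
    using \<nu>(2) by (auto simp: drop_second_column_def)
  ultimately show "is_partition (n - ?h) (drop_second_column \<nu>)"
    using sum by (simp add: is_partition_def)
qed

lemma two_columns_eq: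
  assumes "is_partition n (x # \<nu>)" "x = 2"
  shows "x # \<nu> = add_column (length (filter (\<lambda>x. 2 \<le> x) (x # \<nu>))) (replicate (length (x # \<nu>)) 1)"
    and "n = length (x # \<nu>) + length (filter (\<lambda>x. 2 \<le> x) (x # \<nu>))"
proof -
  have "drop_second_column (x # \<nu>) = replicate (length (x # \<nu>)) 1"
  proof (rule replicate_eqI)
    have "0 < y \<and> y \<le> 2" if "y \<in> set (x # \<nu>)" for y
      using assms that by (auto simp: is_partition_def)
    then show "y = 1" if "y \<in> set (drop_second_column (x # \<nu>))" for y
      using that unfolding drop_second_column_def by fastforce
  qed (simp add: drop_second_column_def)
  then show "x # \<nu> = add_column (length (filter (\<lambda>x. 2 \<le> x) (x # \<nu>))) (replicate (length (x # \<nu>)) 1)"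
    using add_column_drop_second_column[of "x # \<nu>"] assms(1) by (simp add: is_partition_def)
  have "sum_list (drop_second_column (x # \<nu>)) = n - length (filter (\<lambda>x. 2 \<le> x) (x # \<nu>))"
    using is_partition_drop_second_column(1)[OF assms(1)] by (simp only: is_partition_def)
  then show "n = length (x # \<nu>) + length (filter (\<lambda>x. 2 \<le> x) (x # \<nu>))"
    using \<open>drop_second_column (x # \<nu>) = replicate (length (x # \<nu>)) 1\<close>
      is_partition_drop_second_column(2)[OF assms(1)]
    by (simp only: sum_list_replicate) simp
qed

lemma full_cycle_of_shape:
  assumes "is_partition n (x # \<nu>)" "\<nu> \<noteq> []" "2 \<le> x"
  shows "\<exists>\<tau>. cycle_off n {} \<tau> \<and> shape (insertion_tableau n \<tau>) = x # \<nu>"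
  using assms
proof (induction n arbitrary: x \<nu> rule: less_induct)
  case (less n)
  define h where "h = length (filter (\<lambda>x. 2 \<le> x) (x # \<nu>))"
  define p where "p = length (x # \<nu>)"
  have p: "2 \<le> p" "h \<le> p"
    using less.prems(2) length_filter_le[of "\<lambda>x. 2 \<le> x" "x # \<nu>"] unfolding p_def h_def
    by (simp_all add: Suc_le_eq)
  have pos: "0 < y" "y \<le> x" if "y \<in> set \<nu>" for y
    using less.prems(1) that by (auto simp: is_partition_def)
  have "1 \<le> h" using less.prems(3) by (simp add: h_def)
  then consider "h = 1" | "2 \<le> h" "x = 2" | "2 \<le> h" "3 \<le> x"
    using less.prems(3) by linarith
  then show ?case
  proof cases
    case 1
    have "\<nu> = replicate (p - 1) 1"
    proof (rule replicate_eqI)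
      show "y = 1" if "y \<in> set \<nu>" for y
        using 1 less.prems(3) pos(1)[OF that] that by (fastforce simp: h_def filter_empty_conv)
    qed (simp add: p_def)
    then have n: "x # \<nu> = (n - p + 1) # replicate (p - 1) 1" "p < n"
      using less.prems(1,3) p by (auto simp: is_partition_def sum_list_replicate)
    \<comment> \<open>With \<open>k = (p + 1) div 2\<close> and \<open>c = p div 2 + 1\<close> one
      has \<open>c = k\<close> or \<open>c = k + 1\<close>, so no central point stays off the
      cycle.\<close>
    have c: "2 \<le> p div 2 + 1" "p div 2 + 1 \<le> p" "p + 1 = (p + 1) div 2 + (p div 2 + 1)"
      "p div 2 + 1 = (p + 1) div 2 \<or> p div 2 + 1 = (p + 1) div 2 + 1 \<or> p div 2 + 1 + 1 = (p + 1) div 2"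
      and ne: "p div 2 + 1 + 1 \<noteq> (p + 1) div 2"
      using p(1) by presburger+
    obtain \<tau> where \<tau>: "cycle_off n (if p div 2 + 1 + 1 = (p + 1) div 2 then {(p + 1) div 2} else {}) \<tau>"
        "shape (insertion_tableau n \<tau>) = (n - p + 1) # replicate (p - 1) 1"
      by (rule hook_permutation[OF c n(2)])
    show ?thesis using \<tau> ne unfolding n(1) by (simp only: if_False) blast
  next
    case 2
    then have n: "n = p + h" "x # \<nu> = add_column h (replicate p 1)"
      using two_columns_eq[OF less.prems(1)] by (simp_all add: h_def p_def)
    \<comment> \<open>As for hooks, the omitted values are chosen next to the middle of each run,
      now also with \<open>u = h div 2\<close> and \<open>e = (h + 1) div 2\<close>, so that both
      exceptional fixed points are avoided.\<close>
    have c: "2 \<le> p div 2 + 1" "p div 2 + 1 \<le> p" "p + 1 = (p + 1) div 2 + (p div 2 + 1)"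
      "p div 2 + 1 = (p + 1) div 2 \<or> p div 2 + 1 = (p + 1) div 2 + 1 \<or> p div 2 + 1 = (p + 1) div 2 + 2"
      and e: "1 \<le> (h + 1) div 2" "1 \<le> h div 2" "h = h div 2 + (h + 1) div 2"
      "(h + 1) div 2 = h div 2 \<or> (h + 1) div 2 = h div 2 + 1 \<or> (h + 1) div 2 + 1 = h div 2"
      and ne: "p div 2 + 1 \<noteq> (p + 1) div 2 + 2" "(h + 1) div 2 + 1 \<noteq> h div 2"
      using p 2 by presburger+
    obtain \<tau> where \<tau>:
        "cycle_off (p + h) ((if p div 2 + 1 = (p + 1) div 2 + 2 then {(p + 1) div 2 + 1} else {})
          \<union> (if (h + 1) div 2 + 1 = h div 2 then {p + h div 2} else {})) \<tau>"
        "shape (insertion_tableau (p + h) \<tau>) = add_column h (replicate p 1)"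
      by (rule two_column_permutation[OF c e p(2)])
    show ?thesis using \<tau> ne unfolding n by (simp only: if_False Un_empty_left) blast
  next
    case 3
    have eq: "add_column h (drop_second_column (x # \<nu>)) = x # \<nu>"
      using add_column_drop_second_column less.prems(1) unfolding h_def is_partition_def by blast
    have part: "is_partition (n - h) (drop_second_column (x # \<nu>))" "h \<le> n"
      using is_partition_drop_second_column[OF less.prems(1)] by (simp_all only: h_def)
    have cons: "drop_second_column (x # \<nu>) = (x - 1) # drop_second_column \<nu>"
      using less.prems(3) by (simp add: drop_second_column_def)
    have x: "n - h < n" "drop_second_column \<nu> \<noteq> []" "2 \<le> x - 1"
      using part(2) less.prems(2) 3 by (auto simp: drop_second_column_def)
    obtain \<sigma> where \<sigma>: "cycle_off (n - h) {} \<sigma>"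
        "shape (insertion_tableau (n - h) \<sigma>) = drop_second_column (x # \<nu>)"
      using less.IH[of "n - h" "x - 1" "drop_second_column \<nu>"] part x unfolding cons by blast
    \<comment> \<open>Rounding up turns even \<open>h\<close> into the case \<open>h = 2 * j\<close>
      and odd \<open>h\<close> into \<open>h + 1 = 2 * j\<close>, where the cycle absorbs every new
      point.\<close>
    have j: "0 < (h + 1) div 2" "(h + 1) div 2 < h"
      "h = 2 * ((h + 1) div 2) \<or> h + 1 = 2 * ((h + 1) div 2) \<or> h = 2 * ((h + 1) div 2) + 1"
      "h \<noteq> 2 * ((h + 1) div 2) + 1"
      using 3 by presburger+
    obtain \<tau> where
        "cycle_off (n - h + h) (if h = 2 * ((h + 1) div 2) + 1
          then insert (n - h + (h + 1) div 2 + 1) {} else {}) \<tau>"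
        "shape (insertion_tableau (n - h + h) \<tau>) = add_column h (shape (insertion_tableau (n - h) \<sigma>))"
      by (rule insert_column[OF \<sigma>(1) j(1-3)])
    then show ?thesis
      using j(4) part(2) unfolding \<sigma>(2) eq by (simp only: le_add_diff_inverse2 if_False) blast
  qed
qed

text \<open>Equal first rows make every column at least two high, so an odd column has height at
  least three and room for a fixed centre. Even columns are removed, keeping \<open>n\<close> odd,
  until an odd second column or a two-column shape supplies the fixed point.\<close>

lemma cycle_with_fixed_point_of_shape:
  assumes "is_partition n (x # x # \<nu>)" "2 \<le> x" "odd n"
  shows "\<exists>\<tau> f. cycle_off n {f} \<tau> \<and> shape (insertion_tableau n \<tau>) = x # x # \<nu>"
  using assms
proof (induction n arbitrary: x \<nu> rule: less_induct)
  case (less n)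
  define h where "h = length (filter (\<lambda>x. 2 \<le> x) (x # x # \<nu>))"
  define p where "p = length (x # x # \<nu>)"
  have p: "2 \<le> h" "h \<le> p"
    using less.prems(2) length_filter_le[of "\<lambda>x. 2 \<le> x" "x # x # \<nu>"] unfolding p_def h_def
    by simp_all
  show ?case
  proof (cases "x = 2")
    case True
    then have n: "n = p + h" "x # x # \<nu> = add_column h (replicate p 1)"
      using two_columns_eq[OF less.prems(1)] by (simp_all add: h_def p_def)
    \<comment> \<open>Exactly one of \<open>p\<close> and \<open>h\<close> is odd; the run of odd
      length receives the fixed centre, through \<open>c = k + 2\<close> or
      \<open>e + 1 = u\<close>.\<close>
    show ?thesis
    proof (cases "odd p")
      case True
      then obtain r s where rs: "p = 2 * r + 1" "h = 2 * s"
        using less.prems(3) n by (auto elim!: oddE evenE)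
      show ?thesis
        by (rule two_column_permutation[of "r + 2" p r s s h]) (use p rs n in auto)
    next
      case False
      then obtain r s where rs: "p = 2 * r" "h = 2 * s + 1"
        using less.prems(3) n by (auto elim!: oddE evenE)
      show ?thesis
        by (rule two_column_permutation[of "r + 1" p r s "s + 1" h]) (use p rs n in auto)
    qed
  next
    case False
    have eq: "add_column h (drop_second_column (x # x # \<nu>)) = x # x # \<nu>"
      using add_column_drop_second_column less.prems(1) unfolding h_def is_partition_def by blast
    have part: "is_partition (n - h) (drop_second_column (x # x # \<nu>))" "h \<le> n"
      using is_partition_drop_second_column[OF less.prems(1)] by (simp_all only: h_def)
    have cons: "drop_second_column (x # x # \<nu>) = (x - 1) # (x - 1) # drop_second_column \<nu>"
      using less.prems(2) by (simp add: drop_second_column_def)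
    have x: "2 \<le> x - 1" using less.prems(2) False by simp
    \<comment> \<open>For odd \<open>h\<close> the rest is realised by a full cycle and the centre
      of the new column is fixed. For even \<open>h\<close> the fixed point comes from the smaller
      shape.\<close>
    show ?thesis
    proof (cases "odd h")
      case True
      then obtain j where j: "h = 2 * j + 1" by (rule oddE)
      obtain \<sigma> where \<sigma>: "cycle_off (n - h) {} \<sigma>"
          "shape (insertion_tableau (n - h) \<sigma>) = drop_second_column (x # x # \<nu>)"
        using full_cycle_of_shape[of "n - h" "x - 1" "(x - 1) # drop_second_column \<nu>"]
          part x unfolding cons by blast
      obtain \<tau> where
          "cycle_off (n - h + h) (if h = 2 * j + 1 then insert (n - h + j + 1) {} else {}) \<tau>"
          "shape (insertion_tableau (n - h + h) \<tau>) = add_column h (shape (insertion_tableau (n - h) \<sigma>))"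
        by (rule insert_column[OF \<sigma>(1), of j h]) (use j p in auto)
      then show ?thesis
        using j part(2) unfolding \<sigma>(2) eq by (simp only: le_add_diff_inverse2 simp_thms if_True) blast
    next
      case False
      then obtain j where j: "h = 2 * j" by (auto elim: evenE)
      have nh: "n - h < n" "odd (n - h)" using less.prems(3) p part(2) False by auto
      obtain \<sigma> f where \<sigma>: "cycle_off (n - h) {f} \<sigma>"
          "shape (insertion_tableau (n - h) \<sigma>) = drop_second_column (x # x # \<nu>)"
        using less.IH[of "n - h" "x - 1" "drop_second_column \<nu>"] nh
          part x unfolding cons by blast
      obtain \<tau> where
          "cycle_off (n - h + h) (if h = 2 * j + 1 then insert (n - h + j + 1) {f} else {f}) \<tau>"
          "shape (insertion_tableau (n - h + h) \<tau>) = add_column h (shape (insertion_tableau (n - h) \<sigma>))"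
        by (rule insert_column[OF \<sigma>(1), of j h]) (use j p in auto)
      moreover have "h \<noteq> 2 * j + 1" using j by simp
      ultimately show ?thesis
        using part(2) unfolding \<sigma>(2) eq by (simp only: le_add_diff_inverse2 if_False) blast
    qed
  qed
qed

lemma exists_fixed_point_type:
  assumes "is_partition n (x # \<nu>)" "\<nu> \<noteq> []" "2 \<le> x" "odd n"
  shows "\<exists>\<sigma>. \<sigma> permutes {1..n} \<and> cycle_type n \<sigma> = [n - 1, 1] \<and> shape (insertion_tableau n \<sigma>) = x # \<nu>"
proof -
  obtain y \<nu>' where \<nu>: "\<nu> = y # \<nu>'" using assms(2) by (cases \<nu>) auto
  have part: "y \<le> x" "0 < y" "x + y + sum_list \<nu>' = n" "\<And>z. z \<in> set \<nu>' \<Longrightarrow> 0 < z \<and> z \<le> y"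
    "sorted_wrt (\<ge>) (y # \<nu>')"
    using assms(1) by (auto simp: is_partition_def \<nu>)
  have of_cycle: ?thesis if "cycle_off n {f} \<sigma>" "shape (insertion_tableau n \<sigma>) = x # \<nu>" for f \<sigma>
  proof -
    have "f \<in> {1..n}" "\<sigma> f = f" "n \<ge> 2" "cyclic_on \<sigma> ({1..n} - {f})" "\<sigma> permutes {1..n}"
      using that(1) by (auto simp: cycle_off_def)
    then show ?thesis using cycle_type_fixed_point that(2) by blast
  qed
  \<comment> \<open>A permutation of \<open>{1..n - 1}\<close> already fixes \<open>n\<close>; as
    the last and largest letter, \<open>n\<close> lengthens the first row by one.\<close>
  have of_smaller: ?thesis
    if \<sigma>: "cycle_off (n - 1) {} \<sigma>" "shape (insertion_tableau (n - 1) \<sigma>) = (x - 1) # \<nu>" "2 \<le> n" for \<sigma>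
  proof -
    have perm: "\<sigma> permutes {1..n - 1}" and cyc: "cyclic_on \<sigma> {1..n - 1}"
      using \<sigma>(1) by (auto simp: cycle_off_def)
    have n: "{1..n} - {n} = {1..n - 1}" "\<sigma> n = n" using \<sigma>(3) permutes_not_in[OF perm, of n] by auto
    then have "cycle_type n \<sigma> = [n - 1, 1]"
      using \<sigma>(3) cyc by (intro cycle_type_fixed_point[of n]) simp_all
    moreover have "\<sigma> permutes {1..n}" using perm by (rule permutes_subset) auto
    moreover have "shape (insertion_tableau n \<sigma>) = x # \<nu>"
    proof -
      let ?w = "map \<sigma> [1..<Suc (n - 1)]"
      have "\<sigma> i < n" if "i \<in> {1..n - 1}" for i
        using permutes_in_image[OF perm, of i] that by auto
      then have "\<forall>y\<in>set ?w. y < n" by (auto simp del: upt_Suc)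
      moreover have "?w \<noteq> []" using \<sigma>(3) by simp
      ultimately obtain r T where "rsk ?w = r # T" "rsk (?w @ [n]) = (r @ [n]) # T"
        using rsk_snoc_max by blast
      moreover have "map \<sigma> [1..<Suc n] = ?w @ [n]" using \<sigma>(3) n(2) by simp
      ultimately show ?thesis using \<sigma>(2) assms(3)
        unfolding insertion_tableau_eq_rsk shape_def by auto
    qed
    ultimately show ?thesis by blast
  qed
  consider "x = y" | "y < x" "3 \<le> x" | "y < x" "x = 2" "4 \<le> n" | "y < x" "x = 2" "n = 3"
    using part(1-3) assms(3,4) by fastforce
  then show ?thesis
  proof cases
    case 1
    then show ?thesis
      using cycle_with_fixed_point_of_shape[of n x \<nu>'] assms of_cycle unfolding \<nu> by blast
  next
    case 2
    have "z \<le> x - 1" if "z \<in> set \<nu>'" for z using conjunct2[OF part(4)[OF that]] 2(1) by linarith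
    then have "is_partition (n - 1) ((x - 1) # \<nu>)"
      using assms(1) 2 by (auto simp: is_partition_def \<nu>)
    moreover have "2 \<le> x - 1" "2 \<le> n" using 2 part by auto
    ultimately show ?thesis using full_cycle_of_shape[of "n - 1" "x - 1" \<nu>] assms(2) of_smaller by blast
  next
    \<comment> \<open>Without the last box of its first row this shape would be a single column,
      which \<open>full_cycle_of_shape\<close> excludes. The hook word with \<open>c + 1 = k\<close>
      is used instead; being odd, \<open>n\<close> is at least \<open>5\<close>, so
      \<open>c = r\<close> is at least \<open>2\<close>.\<close>
    case 3
    have "y = 1" using 3 part(2) by simp
    have \<nu>_eq: "\<nu> = replicate (length \<nu>) 1" 
    proof (rule replicate_eqI)
      show "z = 1" if "z \<in> set \<nu>" for z
        using that part(4)[of z] \<open>y = 1\<close> unfolding \<nu> by auto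
    qed simp
    have "sum_list \<nu> = length \<nu>"
      using arg_cong[OF \<nu>_eq, of sum_list] unfolding sum_list_replicate by simp
    then have len: "length \<nu> = n - 2" using part(3) 3 by (simp add: \<nu>)
    obtain r where r: "n = 2 * r + 1" using assms(4) by (rule oddE)
    obtain \<tau> where \<tau>: "cycle_off n (if r + 1 = r + 1 then {r + 1} else {}) \<tau>"
        "shape (insertion_tableau n \<tau>) = (n - 2 * r + 1) # replicate (2 * r - 1) 1"
      by (rule hook_permutation[of r "2 * r" "r + 1" n]) (use 3 r in auto)
    have "(n - 2 * r + 1) # replicate (2 * r - 1) 1 = x # \<nu>"
      using 3(2) r \<nu>_eq unfolding len by simp
    then show ?thesis using of_cycle \<tau> by simp
  next
    \<comment> \<open>For \<open>n = 3\<close> the hook word is too short, but on two points the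
      transposition is a full cycle whose shape is a column.\<close>
    case 4
    have \<nu>1: "\<nu> = [1]" using 4 part(2-4) by (cases \<nu>') (force simp: \<nu>)+
    define \<sigma> where "\<sigma> = transpose (1::nat) 2"
    have "2 \<in> orbit \<sigma> 1" using orbit.base[of \<sigma> 1] by (simp add: \<sigma>_def)
    moreover from this have "1 \<in> orbit \<sigma> 1" by (rule orbit_stepI) (simp add: \<sigma>_def)
    moreover have two: "i = 1 \<or> i = 2" if "i \<in> {1..2}" for i :: nat using that by auto
    ultimately have "{1..2} \<subseteq> orbit \<sigma> 1" by blast
    then have "cycle_off 2 {} \<sigma>"
      using two by (intro cycle_offI[where a = 1]) (auto simp: \<sigma>_def transpose_def)
    moreover have "shape (insertion_tableau 2 \<sigma>) = [1, 1]"
      by (simp add: insertion_tableau_def shape_def \<sigma>_def transpose_def upt_rec)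
    ultimately show ?thesis using of_smaller[of \<sigma>] 4 \<nu>1 by simp
  qed
qed

section \<open>Necessity and the final classification\<close>

lemma nontrivial_partition:
  assumes "is_partition n \<nu>" "\<nu> \<noteq> [n]" "\<nu> \<noteq> replicate n 1" "0 < n"
  obtains x \<nu>' where "\<nu> = x # \<nu>'" "\<nu>' \<noteq> []" "2 \<le> x"
proof (cases \<nu>)
  case Nil
  then show ?thesis using assms by (simp add: is_partition_def)
next
  case (Cons x \<nu>')
  have "\<nu>' \<noteq> []" using assms(1,2) Cons by (auto simp: is_partition_def)
  moreover have "2 \<le> x"
  proof (rule ccontr)
    assume "\<not> 2 \<le> x"
    then have "y = 1" if "y \<in> set \<nu>" for y using assms(1) that by (fastforce simp: is_partition_def Cons)
    then have \<nu>: "\<nu> = replicate (length \<nu>) 1" by (intro replicate_eqI) auto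
    have "sum_list \<nu> = length \<nu>"
      using arg_cong[OF \<nu>, of sum_list] unfolding sum_list_replicate by simp
    then have len: "length \<nu> = n" using assms(1) by (simp add: is_partition_def)
    show False using \<nu> assms(3) unfolding len by blast
  qed
  ultimately show ?thesis using Cons that by blast
qed

text \<open>Two test shapes suffice. The balanced one bounds the number of fixed points of the
  common cycle type; \<open>[n - 1, 1]\<close> puts all points that are not fixed on one
  cycle.\<close>

lemma RSK_complete_imp:
  assumes "RSK_complete n \<mu>" "3 \<le> n"
  shows "\<mu> = [n] \<or> odd n \<and> \<mu> = [n - 1, 1]"
proof -
  have "is_partition n [n - 1, 1]" "[n - 1, 1] \<noteq> [n]" "[n - 1, 1] \<noteq> replicate n 1"
    using assms(2) by (auto simp: is_partition_def dest: arg_cong[of _ _ length])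
  then obtain \<sigma> where perm: "\<sigma> permutes {1..n}" and type: "cycle_type n \<sigma> = \<mu>"
      and sh: "shape (insertion_tableau n \<sigma>) = [n - 1, 1]"
    using assms(1) unfolding RSK_complete_def by blast
  let ?l = "[n - n div 2, n div 2]"
  have "is_partition n ?l" "?l \<noteq> [n]" "?l \<noteq> replicate n 1"
    using assms(2) by (auto simp: is_partition_def dest: arg_cong[of _ _ length])
  then obtain \<tau> where perm': "\<tau> permutes {1..n}" and type': "cycle_type n \<tau> = \<mu>"
      and sh': "shape (insertion_tableau n \<tau>) = ?l"
    using assms(1) unfolding RSK_complete_def by blast
  let ?F = "{i \<in> {1..n}. \<sigma> i = i}"
  have "card ?F = card {i \<in> {1..n}. \<tau> i = i}"
    using count_cycle_type[OF perm] count_cycle_type[OF perm'] type type' by simp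
  \<comment> \<open>This says that there are at most \<open>n mod 2\<close> fixed points.\<close>
  then have F: "n + card ?F \<le> 2 * (n - n div 2)" using card_fixed_points_le[OF perm' sh'] by simp
  obtain p where p: "p \<in> {1..n}" and mono: "strict_mono_on ({1..n} - {p}) \<sigma>"
    using increasing_off_one_point[OF sh permutes_inj[OF perm]] .
  have permutation: "permutation \<sigma>" using perm by (auto simp: permutation_permutes)
  have orbit: "i \<in> orbit \<sigma> p" if "i \<in> {1..n} - ?F" for i
    using orbit_increasing_off_one_point[OF perm p mono, of i] that
      orbit_swap[OF permutation_self_in_orbit[OF permutation]] by blast
  have fin: "finite ?F" by simp
  consider "?F = {}" | f where "?F = {f}" "odd n"
  proof (cases "?F = {}")
    case False
    then have "card ?F \<noteq> 0" using fin by simp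
    then have "card ?F = 1 \<and> odd n" using F by presburger
    then show ?thesis using that(2) by (auto simp: card_1_singleton_iff)
  qed
  then show ?thesis
  proof cases
    case 1
    then have "{1..n} = orbit \<sigma> p" using orbit permutes_orbit_subset[OF perm p] by blast
    then have "cyclic_on \<sigma> {1..n}" using p unfolding cyclic_on_def by blast
    then show ?thesis using cycle_type_cyclic[OF perm] assms(2) type by simp
  next
    case (2 f)
    have f: "f \<in> {1..n}" "\<sigma> f = f" using 2(1) by blast+
    have orbit_f: "orbit \<sigma> f = {f}" using f(2) by (simp add: orbit_eq_singleton_iff)
    \<comment> \<open>Some point other than \<open>f\<close> exists; it lies on the orbit of
      \<open>p\<close>, hence \<open>p\<close> is not the fixed point.\<close>
    obtain j where "j \<in> {1..n} - {f}"
    proof -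
      have "(if f = 1 then 2 else 1) \<in> {1..n} - {f}" using assms(2) by auto
      then show ?thesis using that by blast
    qed
    then have "j \<in> orbit \<sigma> p" "j \<noteq> f" using orbit 2(1) by auto
    then have "p \<noteq> f" using orbit_f by auto
    then have "f \<notin> orbit \<sigma> p"
      using orbit_swap[OF permutation_self_in_orbit[OF permutation], of f p] orbit_f by blast
    then have "{1..n} - {f} = orbit \<sigma> p"
      using orbit permutes_orbit_subset[OF perm p] unfolding 2(1) by blast
    then have "cyclic_on \<sigma> ({1..n} - {f})" using p \<open>p \<noteq> f\<close> unfolding cyclic_on_def by blast
    then show ?thesis using cycle_type_fixed_point[of f n \<sigma>] f 2(2) assms(2) type by simp
  qed
qed

theorem theorem5p1:
  fixes n :: nat
  assumes "n \<ge> 3"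
  shows "(even n \<longrightarrow> {\<mu>. RSK_complete n \<mu>} = {[n]}) \<and>
         (odd n \<longrightarrow> {\<mu>. RSK_complete n \<mu>} = {[n], [n - 1, 1]})"
proof -
  have "RSK_complete n [n]"
    unfolding RSK_complete_def
  proof (intro conjI allI impI; (elim conjE)?)
    fix \<nu> assume \<nu>: "is_partition n \<nu>" "\<nu> \<noteq> [n]" "\<nu> \<noteq> replicate n 1"
    obtain x \<nu>' where "\<nu> = x # \<nu>'" "\<nu>' \<noteq> []" "2 \<le> x"
      by (rule nontrivial_partition[OF \<nu>]) (use assms in simp)
    then obtain \<tau> where "cycle_off n {} \<tau>" "shape (insertion_tableau n \<tau>) = \<nu>"
      using full_cycle_of_shape \<nu>(1) by blast
    then show "\<exists>\<sigma>. \<sigma> permutes {1..n} \<and> cycle_type n \<sigma> = [n] \<and> shape (insertion_tableau n \<sigma>) = \<nu>"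
      using cycle_type_cyclic[of \<tau> n] assms by (auto simp: cycle_off_def)
  qed (use assms in \<open>simp add: is_partition_def\<close>)
  moreover have "RSK_complete n [n - 1, 1]" if "odd n"
    unfolding RSK_complete_def
  proof (intro conjI allI impI; (elim conjE)?)
    fix \<nu> assume \<nu>: "is_partition n \<nu>" "\<nu> \<noteq> [n]" "\<nu> \<noteq> replicate n 1"
    obtain x \<nu>' where "\<nu> = x # \<nu>'" "\<nu>' \<noteq> []" "2 \<le> x"
      by (rule nontrivial_partition[OF \<nu>]) (use assms in simp)
    then show "\<exists>\<sigma>. \<sigma> permutes {1..n} \<and> cycle_type n \<sigma> = [n - 1, 1] \<and> shape (insertion_tableau n \<sigma>) = \<nu>"
      using exists_fixed_point_type \<nu>(1) that by blast
  qed (use assms in \<open>simp add: is_partition_def\<close>)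
  ultimately show ?thesis using RSK_complete_imp[OF _ assms] by auto
qed

end
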